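(* Let $M_n$ ($n>3$) be an $n$-dimensional Kenmotsu manifold with structure $(\phi,\xi,\eta,g)$, admitting the semi-symmetric non-metric connection $\nabla$ given by $\nabla_XY=D_XY+g(\phi X,Y)\xi$, where $D$ is the Levi-Civita connection of $g$. Suppose $M_n$ is weakly Ricci-symmetric with respect to $\nabla$; that is, there are $1$-forms $\alpha,\beta,\gamma$ on $M_n$ such that the Ricci tensor $\tilde S$ of $\nabla$ satisfies $$(\nabla_X\tilde S)(Y,Z)=\alpha(X)\tilde S(Y,Z)+\beta(Y)\tilde S(X,Z)+\gamma(Z)\tilde S(X,Y)$$ for all vector fields $X,Y,Z$. Then $\alpha+\beta+\gamma$ is everywhere zero on $M_n$. (Equivalently: there is no such weakly Ricci-symmetric $M_n$ unless $\alpha+\beta+\gamma$ is everywhere zero.)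
   Context: Kenmotsu manifold: an $n$-dimensional smooth Riemannian manifold $(M_n,g)$ with a $1$-form $\eta$, a vector field $\xi$ and a $(1,1)$ tensor field $\phi$ such that for all vector fields $X,Y$: $\phi^2X=-X+\eta(X)\xi$, $\phi\xi=0$, $\eta(\phi X)=0$, $\eta(\xi)=1$, $g(\phi X,\phi Y)=g(X,Y)-\eta(X)\eta(Y)$ (hence $g(\xi,Y)=\eta(Y)$ and $g(\phi X,Y)=-g(X,\phi Y)$), and, with $D$ the Levi-Civita connection of $g$, $(D_X\phi)(Y)=g(\phi X,Y)\xi-\eta(Y)\phi X$ and $D_X\xi=X-\eta(X)\xi$. Semi-symmetric non-metric connection: the linear connection $\nabla_XY=D_XY+g(\phi X,Y)\xi$. Its torsion is $T(X,Y)=2g(\phi X,Y)\xi$, and $(\nabla_Xg)(Y,Z)=-\eta(Y)g(\phi X,Z)-\eta(Z)g(\phi X,Y)$. Its curvature tensor is $R(X,Y)Z=\nabla_X\nabla_YZ-\nabla_Y\nabla_XZ-\nabla_{[X,Y]}Z$, and its Ricci tensor is $\tilde S(Y,Z)=\operatorname{trace}\{X\mapsto R(X,Y)Z\}$ (not necessarily symmetric). $\nabla_X\tilde S$ denotes the usual covariant derivative of the tensor field $\tilde S$ with respect to $\nabla$. Weakly Ricci-symmetric with respect to $\nabla$: a non-flat $n$-dimensional manifold ($n>3$) for which there are $1$-forms $\alpha,\beta,\gamma$ satisfying the displayed identity. *)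

theory Defs
  imports "HOL-Analysis.Analysis" "HOL-Library.Function_Algebras"
begin

section \<open>Real-valued functions as a vector space\<close>

text \<open>
  Tangent vectors are operators on functions. With the pointwise instance below, a tangent space
  is a linear subspace of a real vector space, and the library's \<open>span\<close>, \<open>independent\<close> and
  \<open>representation\<close> apply to it.
\<close>

instantiation "fun" :: (type, real_vector) real_vector
begin

definition scaleR_fun :: "real \<Rightarrow> ('a \<Rightarrow> 'b) \<Rightarrow> 'a \<Rightarrow> 'b" where
  "scaleR_fun c f = (\<lambda>x. c *\<^sub>R f x)"

instance
  by standard (auto simp: scaleR_fun_def fun_eq_iff scaleR_add_right scaleR_add_left)

end

lemma scaleR_fun_apply [simp]: "(c *\<^sub>R f) x = c *\<^sub>R f x"
  by (simp add: scaleR_fun_def)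

definition linear_on_subspace :: "'v::real_vector set \<Rightarrow> ('v \<Rightarrow> 'w::real_vector) \<Rightarrow> bool" where
  "linear_on_subspace V L \<longleftrightarrow>
     (\<forall>u\<in>V. \<forall>v\<in>V. L (u + v) = L u + L v) \<and> (\<forall>c. \<forall>v\<in>V. L (c *\<^sub>R v) = c *\<^sub>R L v)"

text \<open>Trace of an endomorphism \<open>L\<close> of a finite-dimensional subspace \<open>V\<close>, computed in some basis.\<close>

definition endo_trace :: "'v::real_vector set \<Rightarrow> ('v \<Rightarrow> 'v) \<Rightarrow> real" where
  "endo_trace V L =
     (let B = (SOME B. independent B \<and> span B = V) in \<Sum>b\<in>B. representation B (L b) b)"


section \<open>Smooth manifolds\<close>

text \<open>\<open>C\<^sup>k\<close> and \<open>C\<^sup>\<infinity>\<close> maps on an open set \<open>S\<close>, by iterated directional derivatives.\<close>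

primrec Ck_on :: "nat \<Rightarrow> 'e::real_normed_vector set \<Rightarrow> ('e \<Rightarrow> 'f::real_normed_vector) \<Rightarrow> bool" where
  "Ck_on 0 S f \<longleftrightarrow> continuous_on S f"
| "Ck_on (Suc k) S f \<longleftrightarrow>
     (\<forall>x\<in>S. f differentiable (at x)) \<and> (\<forall>v. Ck_on k S (\<lambda>x. frechet_derivative f (at x) v))"

definition smooth_on :: "'e::real_normed_vector set \<Rightarrow> ('e \<Rightarrow> 'f::real_normed_vector) \<Rightarrow> bool" where
  "smooth_on S f \<longleftrightarrow> (\<forall>k. Ck_on k S f)"

text \<open>
  The manifold is the whole type \<open>'a\<close>; a chart \<open>(U, c)\<close> consists of its domain and its coordinate
  map, and the dimension is \<open>CARD('n)\<close>.
\<close>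

type_synonym ('a, 'n) chart = "'a set \<times> ('a \<Rightarrow> real ^ 'n)"

definition is_chart :: "('a::topological_space, 'n::finite) chart \<Rightarrow> bool" where
  "is_chart = (\<lambda>(U, c). open U \<and> open (c ` U) \<and> homeomorphism U (c ` U) c (inv_into U c))"

definition smooth_atlas ::
  "('a::{t2_space, second_countable_topology}, 'n::finite) chart set \<Rightarrow> bool" where
  "smooth_atlas A \<longleftrightarrow>
     (\<forall>ch\<in>A. is_chart ch) \<and>
     (\<Union>(U, c)\<in>A. U) = UNIV \<and>
     (\<forall>(U, c)\<in>A. \<forall>(V, d)\<in>A. smooth_on (c ` (U \<inter> V)) (d \<circ> inv_into U c))"

definition smooth_funs :: "('a::topological_space, 'n::finite) chart set \<Rightarrow> ('a \<Rightarrow> real) set" where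
  "smooth_funs A = {f. \<forall>(U, c)\<in>A. smooth_on (c ` U) (f \<circ> inv_into U c)}"

text \<open>
  Tangent vectors at \<open>p\<close> are the derivations at \<open>p\<close> of the algebra of smooth functions. They are
  total operators in HOL, so they are normalised to be \<open>0\<close> off the smooth functions.
\<close>

type_synonym 'a tangent = "('a \<Rightarrow> real) \<Rightarrow> real"
type_synonym 'a field = "'a \<Rightarrow> 'a tangent"

definition tangent_space ::
  "('a::topological_space, 'n::finite) chart set \<Rightarrow> 'a \<Rightarrow> 'a tangent set" where
  "tangent_space A p = {v.
     linear_on_subspace (smooth_funs A) v \<and>
     (\<forall>f\<in>smooth_funs A. \<forall>h\<in>smooth_funs A. v (f * h) = v f * h p + f p * v h) \<and>
     (\<forall>f. f \<notin> smooth_funs A \<longrightarrow> v f = 0)}"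

definition vector_fields :: "('a::topological_space, 'n::finite) chart set \<Rightarrow> 'a field set" where
  "vector_fields A = {X.
     (\<forall>p. X p \<in> tangent_space A p) \<and>
     (\<forall>f\<in>smooth_funs A. (\<lambda>p. X p f) \<in> smooth_funs A)}"

definition lie_bracket ::
  "('a::topological_space, 'n::finite) chart set \<Rightarrow> 'a field \<Rightarrow> 'a field \<Rightarrow> 'a field" where
  "lie_bracket A X Y = (\<lambda>p f.
     if f \<in> smooth_funs A then X p (\<lambda>q. Y q f) - Y p (\<lambda>q. X q f) else 0)"

definition one_form ::
  "('a::topological_space, 'n::finite) chart set \<Rightarrow> ('a \<Rightarrow> 'a tangent \<Rightarrow> real) \<Rightarrow> bool" where
  "one_form A \<omega> \<longleftrightarrow>
     (\<forall>p. linear_on_subspace (tangent_space A p) (\<omega> p)) \<and>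
     (\<forall>X\<in>vector_fields A. (\<lambda>p. \<omega> p (X p)) \<in> smooth_funs A)"

definition tensor_field_1_1 ::
  "('a::topological_space, 'n::finite) chart set \<Rightarrow> ('a \<Rightarrow> 'a tangent \<Rightarrow> 'a tangent) \<Rightarrow> bool" where
  "tensor_field_1_1 A F \<longleftrightarrow>
     (\<forall>p. linear_on_subspace (tangent_space A p) (F p)) \<and>
     (\<forall>p. \<forall>v\<in>tangent_space A p. F p v \<in> tangent_space A p) \<and>
     (\<forall>X\<in>vector_fields A. (\<lambda>p. F p (X p)) \<in> vector_fields A)"

type_synonym 'a metric_tensor = "'a \<Rightarrow> 'a tangent \<Rightarrow> 'a tangent \<Rightarrow> real"

definition riemannian_metric ::
  "('a::topological_space, 'n::finite) chart set \<Rightarrow> 'a metric_tensor \<Rightarrow> bool" where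
  "riemannian_metric A g \<longleftrightarrow>
     (\<forall>p. \<forall>u\<in>tangent_space A p. linear_on_subspace (tangent_space A p) (g p u)) \<and>
     (\<forall>p. \<forall>u\<in>tangent_space A p. \<forall>v\<in>tangent_space A p. g p u v = g p v u) \<and>
     (\<forall>p. \<forall>u\<in>tangent_space A p. u \<noteq> 0 \<longrightarrow> g p u u > 0) \<and>
     (\<forall>X\<in>vector_fields A. \<forall>Y\<in>vector_fields A. (\<lambda>p. g p (X p) (Y p)) \<in> smooth_funs A)"


section \<open>Linear connections\<close>

type_synonym 'a connection = "'a field \<Rightarrow> 'a field \<Rightarrow> 'a field"

definition linear_connection ::
  "('a::topological_space, 'n::finite) chart set \<Rightarrow> 'a connection \<Rightarrow> bool" where
  "linear_connection A N \<longleftrightarrow>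
     (\<forall>X\<in>vector_fields A. \<forall>Y\<in>vector_fields A. N X Y \<in> vector_fields A) \<and>
     (\<forall>X\<in>vector_fields A. \<forall>Y\<in>vector_fields A. \<forall>Z\<in>vector_fields A.
        N (X + Y) Z = N X Z + N Y Z \<and> N X (Y + Z) = N X Y + N X Z) \<and>
     (\<forall>X\<in>vector_fields A. \<forall>Y\<in>vector_fields A. \<forall>f\<in>smooth_funs A.
        N (\<lambda>p. f p *\<^sub>R X p) Y = (\<lambda>p. f p *\<^sub>R N X Y p) \<and>
        N X (\<lambda>p. f p *\<^sub>R Y p) = (\<lambda>p. X p f *\<^sub>R Y p + f p *\<^sub>R N X Y p))"

definition levi_civita ::
  "('a::topological_space, 'n::finite) chart set \<Rightarrow> 'a metric_tensor \<Rightarrow> 'a connection \<Rightarrow> bool" where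
  "levi_civita A g D \<longleftrightarrow>
     linear_connection A D \<and>
     (\<forall>X\<in>vector_fields A. \<forall>Y\<in>vector_fields A. D X Y - D Y X = lie_bracket A X Y) \<and>
     (\<forall>X\<in>vector_fields A. \<forall>Y\<in>vector_fields A. \<forall>Z\<in>vector_fields A. \<forall>p.
        X p (\<lambda>q. g q (Y q) (Z q)) = g p (D X Y p) (Z p) + g p (Y p) (D X Z p))"

definition curvature ::
  "('a::topological_space, 'n::finite) chart set \<Rightarrow> 'a connection \<Rightarrow>
     'a field \<Rightarrow> 'a field \<Rightarrow> 'a field \<Rightarrow> 'a field" where
  "curvature A N X Y Z = N X (N Y Z) - N Y (N X Z) - N (lie_bracket A X Y) Z"

definition flat :: "('a::topological_space, 'n::finite) chart set \<Rightarrow> 'a connection \<Rightarrow> bool" where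
  "flat A N \<longleftrightarrow>
     (\<forall>X\<in>vector_fields A. \<forall>Y\<in>vector_fields A. \<forall>Z\<in>vector_fields A. curvature A N X Y Z = 0)"

text \<open>
  The endomorphism of the tangent space at \<open>p\<close> given by an endomorphism \<open>F\<close> of the module of vector
  fields: extend \<open>v\<close> to a vector field \<open>X\<close> and take the value of \<open>F X\<close> at \<open>p\<close>. When \<open>F\<close> is linear
  over the smooth functions, the result does not depend on the extension.
\<close>

definition at_point ::
  "('a::topological_space, 'n::finite) chart set \<Rightarrow> ('a field \<Rightarrow> 'a field) \<Rightarrow>
     'a \<Rightarrow> 'a tangent \<Rightarrow> 'a tangent" where
  "at_point A F p v = F (SOME X. X \<in> vector_fields A \<and> X p = v) p"

definition ricci ::
  "('a::topological_space, 'n::finite) chart set \<Rightarrow> 'a connection \<Rightarrow>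
     'a field \<Rightarrow> 'a field \<Rightarrow> 'a \<Rightarrow> real" where
  "ricci A N Y Z p = endo_trace (tangent_space A p) (at_point A (\<lambda>X. curvature A N X Y Z) p)"

text \<open>\<open>cov_deriv N S X Y Z\<close> is \<open>(\<nabla>\<^sub>X S)(Y, Z)\<close> for a \<open>(0,2)\<close> tensor field \<open>S\<close>, with \<open>\<nabla>\<close> given by \<open>N\<close>.\<close>

definition cov_deriv ::
  "'a connection \<Rightarrow> ('a field \<Rightarrow> 'a field \<Rightarrow> 'a \<Rightarrow> real) \<Rightarrow>
     'a field \<Rightarrow> 'a field \<Rightarrow> 'a field \<Rightarrow> 'a \<Rightarrow> real" where
  "cov_deriv N S X Y Z p = X p (S Y Z) - S (N X Y) Z p - S Y (N X Z) p"


section \<open>Kenmotsu manifolds and weak Ricci symmetry\<close>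

definition kenmotsu ::
  "('a::topological_space, 'n::finite) chart set \<Rightarrow> ('a \<Rightarrow> 'a tangent \<Rightarrow> 'a tangent) \<Rightarrow>
     'a field \<Rightarrow> ('a \<Rightarrow> 'a tangent \<Rightarrow> real) \<Rightarrow> 'a metric_tensor \<Rightarrow> 'a connection \<Rightarrow> bool" where
  "kenmotsu A \<phi> \<xi> \<eta> g D \<longleftrightarrow>
     riemannian_metric A g \<and> levi_civita A g D \<and>
     one_form A \<eta> \<and> \<xi> \<in> vector_fields A \<and> tensor_field_1_1 A \<phi> \<and>
     (\<forall>p. \<phi> p (\<xi> p) = 0) \<and> (\<forall>p. \<eta> p (\<xi> p) = 1) \<and>
     (\<forall>X\<in>vector_fields A. \<forall>p.
        \<phi> p (\<phi> p (X p)) = - X p + \<eta> p (X p) *\<^sub>R \<xi> p \<and>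
        \<eta> p (\<phi> p (X p)) = 0 \<and>
        D X \<xi> p = X p - \<eta> p (X p) *\<^sub>R \<xi> p) \<and>
     (\<forall>X\<in>vector_fields A. \<forall>Y\<in>vector_fields A. \<forall>p.
        g p (\<phi> p (X p)) (\<phi> p (Y p)) = g p (X p) (Y p) - \<eta> p (X p) * \<eta> p (Y p) \<and>
        D X (\<lambda>q. \<phi> q (Y q)) p - \<phi> p (D X Y p) =
          g p (\<phi> p (X p)) (Y p) *\<^sub>R \<xi> p - \<eta> p (Y p) *\<^sub>R \<phi> p (X p))"

definition semi_symmetric_connection ::
  "('a \<Rightarrow> 'a tangent \<Rightarrow> 'a tangent) \<Rightarrow> 'a field \<Rightarrow> 'a metric_tensor \<Rightarrow>
     'a connection \<Rightarrow> 'a connection" where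
  "semi_symmetric_connection \<phi> \<xi> g D X Y = (\<lambda>p. D X Y p + g p (\<phi> p (X p)) (Y p) *\<^sub>R \<xi> p)"

definition weakly_ricci_symmetric ::
  "('a::topological_space, 'n::finite) chart set \<Rightarrow> 'a connection \<Rightarrow> ('a \<Rightarrow> 'a tangent \<Rightarrow> real) \<Rightarrow>
     ('a \<Rightarrow> 'a tangent \<Rightarrow> real) \<Rightarrow> ('a \<Rightarrow> 'a tangent \<Rightarrow> real) \<Rightarrow> bool" where
  "weakly_ricci_symmetric A N \<alpha> \<beta> \<gamma> \<longleftrightarrow>
     \<not> flat A N \<and> one_form A \<alpha> \<and> one_form A \<beta> \<and> one_form A \<gamma> \<and>
     (\<forall>X\<in>vector_fields A. \<forall>Y\<in>vector_fields A. \<forall>Z\<in>vector_fields A. \<forall>p.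
        cov_deriv N (ricci A N) X Y Z p =
          \<alpha> p (X p) * ricci A N Y Z p + \<beta> p (Y p) * ricci A N X Z p + \<gamma> p (Z p) * ricci A N X Y p)"

end

theory Submission
  imports Defs
begin

text \<open>
  For a weakly Ricci-symmetric connection only the values of the Ricci tensor with \<open>\<xi>\<close> in one slot
  matter. A direct computation of the curvature gives
  \<open>R(X,Y)\<xi> = \<eta>(X)Y - \<eta>(Y)X + 2g(\<phi>X,Y)\<xi>\<close> and
  \<open>R(X,\<xi>)Z = - \<eta>(Z)X + (g(X,Z) - g(\<phi>X,Z))\<xi>\<close>, so
  \<open>S(Y,\<xi>) = S(\<xi>,Y) = (1 - n)\<eta>(Y)\<close> by taking traces. Since \<open>\<nabla>\<^sub>\<xi>\<xi> = 0\<close>, the covariant derivative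
  \<open>(\<nabla>\<^sub>X S)(Y,Z)\<close> vanishes as soon as two of its three arguments are \<open>\<xi>\<close>. The three resulting
  equations express \<open>\<alpha>, \<beta>, \<gamma>\<close> as multiples of \<open>\<eta>\<close>, and their sum as \<open>- 2 (\<alpha> + \<beta> + \<gamma>)(\<xi>)\<close>
  times \<open>\<eta>\<close>, which is zero because the case \<open>X = Y = Z = \<xi>\<close> gives \<open>(\<alpha> + \<beta> + \<gamma>)(\<xi>) = 0\<close>.
  The traces require that the space of derivations at a point has dimension \<open>n\<close>, which is Hadamard's
  lemma, and that every tangent vector extends to a vector field, which uses bump functions.
\<close>

section \<open>Calculus of smooth functions\<close>

text \<open>On an open set the derivative at a point depends only on nearby values inside the set,
  so agreement passes from the functions to all their derivatives.\<close>

lemma Ck_on_cong: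
  assumes "open S" "\<And>x. x \<in> S \<Longrightarrow> f x = g x" "Ck_on k S f"
  shows "Ck_on k S g"
  using assms(2,3)
proof (induction k arbitrary: f g)
  case 0
  then show ?case by (simp cong: continuous_on_cong)
next
  case (Suc k)
  have d: "(g has_derivative frechet_derivative f (at x)) (at x)" if "x \<in> S" for x
  proof (rule has_derivative_transform_within_open[OF _ \<open>open S\<close> that])
    show "(f has_derivative frechet_derivative f (at x)) (at x)"
      using Suc.prems(2) that by (simp add: frechet_derivative_works[symmetric])
  qed (use Suc.prems(1) in auto)
  then have e: "frechet_derivative g (at x) = frechet_derivative f (at x)" if "x \<in> S" for x
    using that by (metis frechet_derivative_at)
  have "Ck_on k S (\<lambda>x. frechet_derivative g (at x) v)" for v
    by (rule Suc.IH[of "\<lambda>x. frechet_derivative f (at x) v"]) (use e Suc.prems in auto)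
  then show ?case using d by (auto simp: differentiable_def)
qed

text \<open>By uniqueness of the derivative, any derivative produced by the differentiation rules
  may replace \<open>frechet_derivative\<close>. The inductions below use this form of the successor
  step.\<close>

lemma Ck_on_SucI:
  assumes "open S" "\<And>x. x \<in> S \<Longrightarrow> (f has_derivative f' x) (at x)"
    and "\<And>v. Ck_on k S (\<lambda>x. f' x v)"
  shows "Ck_on (Suc k) S f"
proof -
  have "frechet_derivative f (at x) = f' x" if "x \<in> S" for x
    using assms(2)[OF that] by (metis frechet_derivative_at)
  then have "Ck_on k S (\<lambda>x. frechet_derivative f (at x) v)" for v
    by (intro Ck_on_cong[OF assms(1) _ assms(3)[of v]]) simp
  then show ?thesis using assms(2) by (auto simp: differentiable_def)
qed

lemma Ck_on_Suc_derivative: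
  assumes "Ck_on (Suc k) S f" "x \<in> S"
  shows "(f has_derivative frechet_derivative f (at x)) (at x)"
  using assms by (simp add: frechet_derivative_works[symmetric])

lemma Ck_on_1_derivative:
  assumes "Ck_on 1 S f" "x \<in> S"
  shows "(f has_derivative frechet_derivative f (at x)) (at x)"
  using assms by (intro Ck_on_Suc_derivative[of 0]) auto

lemma Ck_on_Suc_imp: "Ck_on (Suc k) S f \<Longrightarrow> Ck_on k S f"
proof (induction k arbitrary: f)
  case 0
  then show ?case
    by (auto intro!: continuous_at_imp_continuous_on differentiable_imp_continuous_within)
next
  case (Suc k)
  then show ?case by (metis Ck_on.simps(2))
qed

lemma Ck_on_imp_continuous_on: "Ck_on k S f \<Longrightarrow> continuous_on S f"
  by (induction k) (use Ck_on_Suc_imp in auto)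

lemma Ck_on_Suc_imp_1: "Ck_on (Suc k) S f \<Longrightarrow> Ck_on 1 S f"
  using Ck_on_imp_continuous_on by fastforce

lemma Ck_on_const: "open S \<Longrightarrow> Ck_on k S (\<lambda>x. c)"
proof (induction k arbitrary: c)
  case (Suc k)
  then show ?case by (intro Ck_on_SucI[where f'="\<lambda>x v. 0"]) auto
qed simp

lemma Ck_on_add:
  "open S \<Longrightarrow> Ck_on k S f \<Longrightarrow> Ck_on k S g \<Longrightarrow> Ck_on k S (\<lambda>x. f x + g x)"
proof (induction k arbitrary: f g)
  case 0
  then show ?case by (simp add: continuous_on_add)
next
  case (Suc k)
  show ?case
    by (rule Ck_on_SucI[OF Suc.prems(1)
          has_derivative_add[OF Ck_on_Suc_derivative[OF Suc.prems(2)] Ck_on_Suc_derivative[OF Suc.prems(3)]]])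
      (use Suc in auto)
qed

lemma Ck_on_sum:
  "open S \<Longrightarrow> (\<And>i. i \<in> I \<Longrightarrow> Ck_on k S (f i)) \<Longrightarrow> Ck_on k S (\<lambda>x. \<Sum>i\<in>I. f i x)"
  by (induction I rule: infinite_finite_induct) (auto intro: Ck_on_const Ck_on_add)

lemma Ck_on_bounded_linear_comp:
  assumes "bounded_linear L" "open S"
  shows "Ck_on k S f \<Longrightarrow> Ck_on k S (\<lambda>x. L (f x))"
proof (induction k arbitrary: f)
  case 0
  then show ?case using assms by (simp add: bounded_linear.continuous_on)
next
  case (Suc k)
  show ?case
    by (rule Ck_on_SucI[OF assms(2)
          bounded_linear.has_derivative[OF assms(1) Ck_on_Suc_derivative[OF Suc.prems]]])
      (use Suc in auto)
qed

lemma Ck_on_mult: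
  fixes f g :: "'e::real_normed_vector \<Rightarrow> real"
  assumes "open S"
  shows "Ck_on k S f \<Longrightarrow> Ck_on k S g \<Longrightarrow> Ck_on k S (\<lambda>x. f x * g x)"
proof (induction k arbitrary: f g)
  case 0
  then show ?case by (simp add: continuous_on_mult)
next
  case (Suc k)
  \<comment> \<open>The product rule leaves one factor undifferentiated, so both factors are also
    needed one order lower.\<close>
  note lower = Suc.prems[THEN Ck_on_Suc_imp]
  show ?case
  proof (rule Ck_on_SucI[OF assms
          has_derivative_mult[OF Ck_on_Suc_derivative[OF Suc.prems(1)] Ck_on_Suc_derivative[OF Suc.prems(2)]]])
    fix v
    show "Ck_on k S (\<lambda>x. f x * frechet_derivative g (at x) v + frechet_derivative f (at x) v * g x)"
      by (intro Ck_on_add Suc.IH assms lower) (use Suc.prems in auto)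
  qed
qed

lemma Ck_on_id: "open S \<Longrightarrow> Ck_on k S (\<lambda>x. x)"
proof (cases k)
  case (Suc m)
  assume "open S"
  then show ?thesis unfolding Suc
    by (intro Ck_on_SucI[where f'="\<lambda>x v. v"]) (auto intro: Ck_on_const)
qed simp

lemma Ck_on_bounded_linear: "bounded_linear L \<Longrightarrow> open S \<Longrightarrow> Ck_on k S L"
  using Ck_on_bounded_linear_comp[of L S k "\<lambda>x. x"] Ck_on_id by fastforce

lemma linear_Basis_expansion:
  fixes L :: "'e::euclidean_space \<Rightarrow> real"
  assumes "linear L"
  shows "L v = (\<Sum>b\<in>Basis. (v \<bullet> b) * L b)"
proof -
  have "L v = L (\<Sum>b\<in>Basis. (v \<bullet> b) *\<^sub>R b)"
    by (simp add: euclidean_representation)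
  also have "\<dots> = (\<Sum>b\<in>Basis. (v \<bullet> b) * L b)"
    by (simp add: linear_sum[OF assms] linear_cmul[OF assms])
  finally show ?thesis .
qed

text \<open>In the chain rule the derivative of \<open>h\<close> is applied to a vector that itself
  varies with the point. Expanding this vector in \<open>Basis\<close> gives products of scalar
  functions: its coordinates come from \<open>g\<close>, and the partial derivatives of
  \<open>h\<close> composed with \<open>g\<close> fall under the induction hypothesis.\<close>

lemma Ck_on_compose:
  fixes h :: "'f::euclidean_space \<Rightarrow> real"
  assumes "open S" "g ` S \<subseteq> T"
  shows "Ck_on k T h \<Longrightarrow> Ck_on k S g \<Longrightarrow> Ck_on k S (\<lambda>x. h (g x))"
proof (induction k arbitrary: h)
  case 0
  then show ?case using assms
    by (metis Ck_on.simps(1) continuous_on_compose2)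
next
  case (Suc k)
  let ?g' = "\<lambda>x. frechet_derivative g (at x)" and ?h' = "\<lambda>x. frechet_derivative h (at x)"
  have hd: "(h has_derivative ?h' (g x)) (at (g x))" if "x \<in> S" for x
    using Ck_on_Suc_derivative[OF Suc.prems(1)] that assms(2) by blast
  have 1: "((\<lambda>x. h (g x)) has_derivative (\<lambda>v. ?h' (g x) (?g' x v))) (at x)" if "x \<in> S" for x
    using diff_chain_at[OF Ck_on_Suc_derivative[OF Suc.prems(2) that] hd[OF that]]
    by (simp add: o_def)
  have 2: "?h' (g x) (?g' x v) = (\<Sum>b\<in>Basis. (?g' x v \<bullet> b) * ?h' (g x) b)" if "x \<in> S" for x v
    using hd[OF that] by (intro linear_Basis_expansion has_derivative_linear)
  show ?case
  proof (rule Ck_on_SucI[OF assms(1) 1])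
    fix v
    have "Ck_on k S (\<lambda>x. \<Sum>b\<in>Basis. (?g' x v \<bullet> b) * ?h' (g x) b)"
    proof (intro Ck_on_sum Ck_on_mult assms(1))
      fix b :: 'f
      show "Ck_on k S (\<lambda>x. ?g' x v \<bullet> b)"
        by (rule Ck_on_bounded_linear_comp[OF bounded_linear_inner_left assms(1)])
          (use Suc.prems in simp)
      show "Ck_on k S (\<lambda>x. ?h' (g x) b)"
        by (rule Suc.IH) (use Suc.prems Ck_on_Suc_imp in auto)
    qed
    then show "Ck_on k S (\<lambda>x. ?h' (g x) (?g' x v))"
      by (rule Ck_on_cong[OF assms(1), rotated]) (simp add: 2)
  qed
qed

text \<open>Differentiability is a condition at each point; only the continuity at the bottom of the
  induction needs both sets to be open.\<close>

lemma Ck_on_Un: "open S \<Longrightarrow> open T \<Longrightarrow> Ck_on k S f \<Longrightarrow> Ck_on k T f \<Longrightarrow> Ck_on k (S \<union> T) f"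
  by (induction k arbitrary: f) (auto intro: continuous_on_open_Un)

lemma Ck_on_subset: "Ck_on k T f \<Longrightarrow> S \<subseteq> T \<Longrightarrow> Ck_on k S f"
  by (induction k arbitrary: f) (auto intro: continuous_on_subset)


section \<open>Flat functions and bump functions\<close>

text \<open>For \<open>n = 0\<close> this is the classical smooth, non-analytic function exp(-1/x).
  The extra powers of 1/x give a family whose derivatives are combinations of its own
  members.\<close>

definition flat_fun :: "nat \<Rightarrow> real \<Rightarrow> real" where
  "flat_fun n x = (if x > 0 then exp (- inverse x) * inverse x ^ n else 0)"

text \<open>Substituting y = 1/x turns the claim into the decay of y^n / exp y at infinity.\<close>

lemma flat_fun_tendsto: "((\<lambda>x. exp (- inverse x) * inverse x ^ n) \<longlongrightarrow> 0) (at_right (0::real))"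
proof -
  have "((\<lambda>y::real. y ^ n / exp y) \<longlongrightarrow> 0) at_top"
    by (rule tendsto_power_div_exp_0)
  from filterlim_compose[OF this filterlim_inverse_at_top_right]
  show ?thesis by (simp add: exp_minus divide_inverse mult.commute)
qed

lemma flat_fun_deriv:
  "(flat_fun n has_real_derivative flat_fun (n + 2) x - real n * flat_fun (n + 1) x) (at x)"
proof -
  consider "x > 0" | "x < 0" | "x = 0" by linarith
  then show ?thesis
  proof cases
    case 1
    have "((\<lambda>x. exp (- inverse x) * inverse x ^ n) has_real_derivative
        exp (- inverse x) * (inverse x * inverse x) * inverse x ^ n
        - exp (- inverse x) * (real n * inverse x ^ (n - Suc 0) * (inverse x * inverse x))) (at x)"
      using 1 by (auto intro!: derivative_eq_intros simp: algebra_simps)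
    \<comment> \<open>For \<open>n = 0\<close> the truncated exponent is harmless because of the
      factor \<open>real n\<close>.\<close>
    also have "real n * inverse x ^ (n - Suc 0) * (inverse x * inverse x) = real n * inverse x ^ (n + 1)"
      by (cases n) (simp_all add: algebra_simps)
    finally have "((\<lambda>x. exp (- inverse x) * inverse x ^ n) has_real_derivative
        flat_fun (n + 2) x - real n * flat_fun (n + 1) x) (at x)"
      using 1 by (simp add: flat_fun_def algebra_simps)
    then show ?thesis
      by (rule has_field_derivative_transform_within_open[of _ _ _ "{0<..}"])
        (use 1 in \<open>auto simp: flat_fun_def\<close>)
  next
    case 2
    have "((\<lambda>x. 0) has_real_derivative
        flat_fun (n + 2) x - real n * flat_fun (n + 1) x) (at x)"
      using 2 by (simp add: flat_fun_def)
    then show ?thesis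
      by (rule has_field_derivative_transform_within_open[of _ _ _ "{..<0}"])
        (use 2 in \<open>auto simp: flat_fun_def\<close>)
  next
    case 3
    \<comment> \<open>To the right of 0 the difference quotient is exactly
      \<open>flat_fun (n + 1)\<close>; to the left it is 0.\<close>
    have "((\<lambda>h. (flat_fun n (0 + h) - flat_fun n 0) / h) \<longlongrightarrow> 0) (at_right 0)"
      by (rule tendsto_cong[THEN iffD1, OF _ flat_fun_tendsto[of "n + 1"]])
        (auto simp: eventually_at_filter flat_fun_def field_simps)
    moreover have "((\<lambda>h. (flat_fun n (0 + h) - flat_fun n 0) / h) \<longlongrightarrow> 0) (at_left 0)"
      by (rule tendsto_cong[THEN iffD1, OF _ tendsto_const[of 0]])
        (auto simp: eventually_at_filter flat_fun_def field_simps)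
    ultimately have "((\<lambda>h. (flat_fun n (0 + h) - flat_fun n 0) / h) \<longlongrightarrow> 0) (at 0)"
      by (simp add: filterlim_split_at)
    then show ?thesis using 3 by (simp add: DERIV_def flat_fun_def)
  qed
qed

lemma Ck_on_flat_fun: "Ck_on k UNIV (flat_fun n)"
proof (induction k arbitrary: n)
  case 0
  then show ?case
    using flat_fun_deriv by (auto intro!: continuous_at_imp_continuous_on DERIV_isCont)
next
  case (Suc k)
  show ?case
  proof (rule Ck_on_SucI[OF open_UNIV flat_fun_deriv[unfolded has_field_derivative_def]])
    fix v
    have "Ck_on k UNIV (\<lambda>x. (flat_fun (n + 2) x + - real n * flat_fun (n + 1) x) * v)"
      by (intro Ck_on_mult Ck_on_add Ck_on_const Suc open_UNIV)
    then show "Ck_on k UNIV (\<lambda>x. (flat_fun (n + 2) x - real n * flat_fun (n + 1) x) * v)"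
      by simp
  qed
qed

lemma bump_function_exists:
  fixes a :: "'e::euclidean_space"
  assumes "r > 0"
  obtains b :: "'e \<Rightarrow> real" where "\<And>k. Ck_on k UNIV b" "b a = 1" "\<And>x. x \<notin> ball a r \<Longrightarrow> b x = 0"
proof
  \<comment> \<open>The bump is \<open>flat_fun 0\<close> of r^2 - |x - a|^2, which is positive
    precisely in the ball, divided by its value at the centre. Differences are spelled as sums and
    products so that the \<open>Ck_on\<close> rules apply directly.\<close>
  let ?q = "\<lambda>x. r\<^sup>2 + - 1 * (\<Sum>i\<in>Basis. (x \<bullet> i + - (a \<bullet> i)) * (x \<bullet> i + - (a \<bullet> i)))"
  let ?b = "\<lambda>x. inverse (flat_fun 0 (r\<^sup>2)) * flat_fun 0 (?q x)"
  have "?q x = r\<^sup>2 - (dist a x)\<^sup>2" for x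
  proof -
    have "(dist a x)\<^sup>2 = (x - a) \<bullet> (x - a)"
      by (simp add: dist_norm norm_minus_commute[of a] power2_norm_eq_inner)
    also have "\<dots> = (\<Sum>i\<in>Basis. (x \<bullet> i + - (a \<bullet> i)) * (x \<bullet> i + - (a \<bullet> i)))"
      by (subst euclidean_inner) (simp add: inner_diff_left)
    finally show ?thesis by simp
  qed
  note q = this
  show "Ck_on k UNIV ?b" for k
    by (intro Ck_on_mult Ck_on_const Ck_on_compose[OF open_UNIV subset_UNIV Ck_on_flat_fun]
        Ck_on_add Ck_on_sum open_UNIV Ck_on_bounded_linear bounded_linear_inner_left)
  show "?b a = 1" using assms by (simp add: q flat_fun_def)
  show "?b x = 0" if "x \<notin> ball a r" for x
  proof -
    have "r\<^sup>2 \<le> (dist a x)\<^sup>2" using that assms by (intro power_mono) auto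
    then show ?thesis unfolding q by (simp add: flat_fun_def)
  qed
qed

section \<open>Averages along segments and Hadamard's lemma\<close>

text \<open>The weight \<open>t ^ m\<close> makes the family closed under differentiation, which turns \<open>m\<close>
  into \<open>Suc m\<close>.\<close>

definition segment_average :: "nat \<Rightarrow> ('e::real_normed_vector \<Rightarrow> real) \<Rightarrow> 'e \<Rightarrow> 'e \<Rightarrow> real" where
  "segment_average m f a x = integral (cbox 0 1) (\<lambda>t. t ^ m * f (a + t *\<^sub>R (x - a)))"

lemma segment_in_ball:
  fixes a x :: "'e::real_normed_vector"
  assumes "x \<in> ball a r" "t \<in> cbox 0 (1::real)"
  shows "a + t *\<^sub>R (x - a) \<in> ball a r"
proof -
  have "norm (t *\<^sub>R (x - a)) \<le> norm (x - a)"
    using assms(2) by (simp add: mult_left_le_one_le)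
  also have "\<dots> < r" using assms(1) by (simp add: dist_norm norm_minus_commute)
  finally show ?thesis by (simp add: dist_norm)
qed

lemma continuous_on_segment:
  fixes a :: "'e::real_normed_vector" and f :: "'e \<Rightarrow> real"
  assumes "continuous_on (ball a r) f"
  shows "continuous_on (ball a r \<times> cbox 0 1) (\<lambda>(x, t). t ^ m * f (a + t *\<^sub>R (x - a)))"
proof -
  have "continuous_on (ball a r \<times> cbox 0 1) (\<lambda>z. f (a + snd z *\<^sub>R (fst z - a)))"
    by (rule continuous_on_compose2[OF assms])
      (auto intro!: continuous_intros simp del: mem_ball cbox_interval intro: segment_in_ball)
  then show ?thesis by (auto simp: case_prod_beta intro!: continuous_intros)
qed

lemma integrable_on_segment:
  fixes a :: "'e::real_normed_vector" and f :: "'e \<Rightarrow> real"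
  assumes "continuous_on (ball a r) f" "x \<in> ball a r"
  shows "(\<lambda>t. t ^ m * f (a + t *\<^sub>R (x - a))) integrable_on cbox 0 1"
proof (rule integrable_continuous)
  have "continuous_on (cbox 0 1) (\<lambda>t. case (x, t) of (x, t) \<Rightarrow> t ^ m * f (a + t *\<^sub>R (x - a)))"
    by (rule continuous_on_compose2[OF continuous_on_segment[OF assms(1)]])
      (use assms(2) in \<open>auto intro!: continuous_intros\<close>)
  then show "continuous_on (cbox 0 1) (\<lambda>t. t ^ m * f (a + t *\<^sub>R (x - a)))"
    by simp
qed

text \<open>Differentiation under the integral sign; the inner derivative of a + t(x - a) is
  multiplication by t, which raises the weight by one.\<close>

lemma segment_average_has_derivative:
  fixes a x :: "'e::euclidean_space"
  assumes "Ck_on 1 (ball a r) f" "x \<in> ball a r"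
  shows "(segment_average m f a has_derivative
    (\<lambda>v. segment_average (Suc m) (\<lambda>y. frechet_derivative f (at y) v) a x)) (at x)"
proof -
  let ?f' = "\<lambda>y. frechet_derivative f (at y)"
  \<comment> \<open>The derivative of the integrand as a bounded linear map, which
    \<open>leibniz_rule\<close> requires. Written in the basis, its joint continuity in x and t
    reduces to that of the partial derivatives.\<close>
  define F where "F = (\<lambda>x t. (\<Sum>b\<in>Basis. (t ^ Suc m * ?f' (a + t *\<^sub>R (x - a)) b) *\<^sub>R blinfun_inner_right b))"
  have der: "(f has_derivative ?f' y) (at y)" if "y \<in> ball a r" for y
    using Ck_on_1_derivative[OF assms(1) that] .
  have cont: "continuous_on (ball a r) (\<lambda>y. ?f' y v)" for v
    using assms(1) by simp
  have exp: "?f' y v = (\<Sum>b\<in>Basis. ?f' y b * (v \<bullet> b))" if "y \<in> ball a r" for y v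
    by (subst linear_Basis_expansion[OF has_derivative_linear[OF der[OF that]]])
      (simp only: mult.commute)
  have F: "blinfun_apply (F x t) v = t ^ Suc m * ?f' (a + t *\<^sub>R (x - a)) v"
    if "x \<in> ball a r" "t \<in> cbox 0 1" for x t v
    by (subst exp[OF segment_in_ball[OF that]])
      (simp add: F_def blinfun.sum_left blinfun.scaleR_left sum_distrib_left mult_ac inner_commute)
  have cF: "continuous_on (ball a r \<times> cbox 0 1) (\<lambda>(x, t). F x t)"
    unfolding F_def case_prod_beta
    using continuous_on_segment[OF cont, of "Suc m"] unfolding case_prod_beta
    by (intro continuous_on_sum continuous_on_scaleR continuous_on_const)
  have D: "((\<lambda>x. integral (cbox 0 1) (\<lambda>t. t ^ m * f (a + t *\<^sub>R (x - a)))) has_derivative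
      blinfun_apply (integral (cbox 0 1) (F x))) (at x within ball a r)"
  proof (rule leibniz_rule[OF _ _ cF assms(2) convex_ball])
    fix x t :: _ assume xt: "x \<in> ball a r" "t \<in> cbox 0 (1::real)"
    have "((\<lambda>x. a + t *\<^sub>R (x - a)) has_derivative (\<lambda>v. t *\<^sub>R v)) (at x)"
      by (auto intro!: derivative_eq_intros)
    from diff_chain_at[OF this der[OF segment_in_ball[OF xt]]]
    have "((\<lambda>x. t ^ m * f (a + t *\<^sub>R (x - a))) has_derivative
        (\<lambda>v. t ^ m * ?f' (a + t *\<^sub>R (x - a)) (t *\<^sub>R v))) (at x)"
      by (intro has_derivative_mult_right) (simp add: o_def)
    moreover have "(\<lambda>v. t ^ m * ?f' (a + t *\<^sub>R (x - a)) (t *\<^sub>R v)) = blinfun_apply (F x t)"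
      using has_derivative_linear[OF der[OF segment_in_ball[OF xt]]]
      by (simp add: fun_eq_iff F[OF xt] linear_cmul)
    ultimately show "((\<lambda>x. t ^ m * f (a + t *\<^sub>R (x - a))) has_derivative blinfun_apply (F x t)) (at x within ball a r)"
      by (simp add: has_derivative_at_withinI)
  next
    fix x assume "x \<in> ball a r"
    then show "(\<lambda>t. t ^ m * f (a + t *\<^sub>R (x - a))) integrable_on cbox 0 1"
      by (rule integrable_on_segment[OF Ck_on_imp_continuous_on[OF assms(1)]])
  qed
  have "blinfun_apply (integral (cbox 0 1) (F x)) v =
      segment_average (Suc m) (\<lambda>y. ?f' y v) a x" for v
  proof -
    have "continuous_on (cbox 0 1) (\<lambda>t. case (x, t) of (x, t) \<Rightarrow> F x t)"
      by (rule continuous_on_compose2[OF cF])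
        (use assms(2) in \<open>auto intro!: continuous_intros\<close>)
    then have "F x integrable_on cbox 0 1"
      by (intro integrable_continuous) simp
    then have "blinfun_apply (integral (cbox 0 1) (F x)) v = integral (cbox 0 1) (\<lambda>t. blinfun_apply (F x t) v)"
      by (rule blinfun_apply_integral)
    also have "\<dots> = segment_average (Suc m) (\<lambda>y. ?f' y v) a x"
      unfolding segment_average_def by (rule integral_cong) (use F[OF assms(2)] in simp)
    finally show ?thesis .
  qed
  then have eq: "blinfun_apply (integral (cbox 0 1) (F x)) =
      (\<lambda>v. segment_average (Suc m) (\<lambda>y. ?f' y v) a x)" by blast
  have "segment_average m f a = (\<lambda>x. integral (cbox 0 1) (\<lambda>t. t ^ m * f (a + t *\<^sub>R (x - a))))"
    by (simp add: segment_average_def fun_eq_iff)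
  then show ?thesis
    using D unfolding eq at_within_open[OF assms(2) open_ball] by metis
qed

lemma Ck_on_segment_average:
  fixes a :: "'e::euclidean_space"
  shows "Ck_on k (ball a r) f \<Longrightarrow> Ck_on k (ball a r) (segment_average m f a)"
proof (induction k arbitrary: f m)
  case 0
  then show ?case
    using integral_continuous_on_param[OF continuous_on_segment]
    by (simp add: segment_average_def[abs_def])
next
  case (Suc k)
  have "Ck_on 1 (ball a r) f"
    using Suc.prems by (rule Ck_on_Suc_imp_1)
  from segment_average_has_derivative[OF this]
  show ?case
    by (rule Ck_on_SucI[OF open_ball]) (use Suc in auto)
qed

text \<open>The fundamental theorem of calculus along the segment from \<open>a\<close> to
  \<open>x\<close>, with the derivative in the direction x - a expanded in the basis.\<close>

lemma hadamard:
  fixes a x :: "'e::euclidean_space"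
  assumes "Ck_on 1 (ball a r) f" "x \<in> ball a r"
  shows "f x - f a = (\<Sum>b\<in>Basis. ((x - a) \<bullet> b) * segment_average 0 (\<lambda>y. frechet_derivative f (at y) b) a x)"
proof -
  let ?f' = "\<lambda>y. frechet_derivative f (at y)"
  have der: "(f has_derivative ?f' y) (at y)" if "y \<in> ball a r" for y
    using Ck_on_1_derivative[OF assms(1) that] .
  have exp: "?f' y v = (\<Sum>b\<in>Basis. (v \<bullet> b) * ?f' y b)" if "y \<in> ball a r" for y v
    by (rule linear_Basis_expansion[OF has_derivative_linear[OF der[OF that]]])
  have "((\<lambda>t. ?f' (a + t *\<^sub>R (x - a)) (x - a)) has_integral f (a + 1 *\<^sub>R (x - a)) - f (a + 0 *\<^sub>R (x - a))) {0..1}"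
  proof (rule fundamental_theorem_of_calculus)
    fix t :: real assume t: "t \<in> {0..1}"
    have s: "a + t *\<^sub>R (x - a) \<in> ball a r" using segment_in_ball[OF assms(2)] t by simp
    have "((\<lambda>t. a + t *\<^sub>R (x - a)) has_derivative (\<lambda>h. h *\<^sub>R (x - a))) (at t)"
      by (auto intro!: derivative_eq_intros)
    from diff_chain_at[OF this der[OF s]]
    have "((\<lambda>t. f (a + t *\<^sub>R (x - a))) has_derivative (\<lambda>h. ?f' (a + t *\<^sub>R (x - a)) (h *\<^sub>R (x - a)))) (at t)"
      unfolding o_def .
    then have "((\<lambda>t. f (a + t *\<^sub>R (x - a))) has_vector_derivative ?f' (a + t *\<^sub>R (x - a)) (x - a)) (at t)"
      unfolding has_vector_derivative_def linear_cmul[OF has_derivative_linear[OF der[OF s]]] .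
    then show "((\<lambda>t. f (a + t *\<^sub>R (x - a))) has_vector_derivative ?f' (a + t *\<^sub>R (x - a)) (x - a)) (at t within {0..1})"
      by (rule has_vector_derivative_at_within)
  qed simp
  then have "f x - f a = integral (cbox 0 1) (\<lambda>t. ?f' (a + t *\<^sub>R (x - a)) (x - a))"
    by (simp add: integral_unique)
  also have "\<dots> = integral (cbox 0 1) (\<lambda>t. \<Sum>b\<in>Basis. ((x - a) \<bullet> b) * (t ^ 0 * ?f' (a + t *\<^sub>R (x - a)) b))"
  proof (rule integral_cong)
    fix t :: real assume "t \<in> cbox 0 1"
    from exp[OF segment_in_ball[OF assms(2) this], of "x - a"]
    show "?f' (a + t *\<^sub>R (x - a)) (x - a) = (\<Sum>b\<in>Basis. ((x - a) \<bullet> b) * (t ^ 0 * ?f' (a + t *\<^sub>R (x - a)) b))"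
      by simp
  qed
  also have "\<dots> = (\<Sum>b\<in>Basis. ((x - a) \<bullet> b) * segment_average 0 (\<lambda>y. ?f' y b) a x)"
  proof -
    have "(\<lambda>t. t ^ 0 * ?f' (a + t *\<^sub>R (x - a)) b) integrable_on cbox 0 1" for b
      by (rule integrable_on_segment[OF _ assms(2)]) (use assms(1) in simp)
    then show ?thesis unfolding segment_average_def
      by (subst integral_sum) (auto intro!: integrable_on_mult_right)
  qed
  finally show ?thesis .
qed

lemma segment_average_center: "segment_average 0 f a a = f a"
  by (simp add: segment_average_def)

section \<open>Tangent spaces of a smooth manifold\<close>

lemma chart_inverse:
  assumes "is_chart (U, c)"
  shows "q \<in> U \<Longrightarrow> inv_into U c (c q) = q" "y \<in> c ` U \<Longrightarrow> c (inv_into U c y) = y"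
  using assms by (auto simp: is_chart_def homeomorphism_def)

lemma chart_open_image:
  assumes "is_chart (U, c)" "open W" "W \<subseteq> U"
  shows "open (c ` W)"
proof -
  have "open (c ` U \<inter> inv_into U c -` W)"
    using assms by (intro continuous_open_preimage) (auto simp: is_chart_def homeomorphism_def)
  moreover have "c ` U \<inter> inv_into U c -` W = c ` W"
    using chart_inverse[OF assms(1)] assms(3) by auto
  ultimately show ?thesis by simp
qed

lemma smooth_funsD:
  "f \<in> smooth_funs A \<Longrightarrow> (U, c) \<in> A \<Longrightarrow> Ck_on k (c ` U) (f \<circ> inv_into U c)"
  by (auto simp: smooth_funs_def smooth_on_def)

lemma smooth_fun_frechet:
  assumes "f \<in> smooth_funs A" "(U, c) \<in> A" "q \<in> U"
  shows "((f \<circ> inv_into U c) has_derivative frechet_derivative (f \<circ> inv_into U c) (at (c q))) (at (c q))"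
  using assms by (intro Ck_on_1_derivative[OF smooth_funsD]) auto

text \<open>The directional derivative along \<open>w\<close> in coordinates. The value 0 off the
  smooth functions matches the normalisation in \<open>tangent_space\<close>.\<close>

definition chart_tangent ::
  "('a::topological_space, 'n::finite) chart set \<Rightarrow> ('a, 'n) chart \<Rightarrow> 'a \<Rightarrow> real ^ 'n \<Rightarrow> 'a tangent" where
  "chart_tangent A = (\<lambda>(U, c) q w f.
     if f \<in> smooth_funs A then frechet_derivative (f \<circ> inv_into U c) (at (c q)) w else 0)"

lemma sum_fun_apply: "(\<Sum>i\<in>I. f i) x = (\<Sum>i\<in>I. f i x)"
  by (induction I rule: infinite_finite_induct) auto

lemma sum_on_subspace:
  assumes "linear_on_subspace V L" "subspace V" "\<And>i. i \<in> I \<Longrightarrow> f i \<in> V"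
  shows "L (\<Sum>i\<in>I. f i) = (\<Sum>i\<in>I. L (f i))"
  using assms(3)
proof (induction I rule: infinite_finite_induct)
  case (insert i I)
  have "L (f i + sum f I) = L (f i) + L (sum f I)"
    using assms(1) insert.prems subspace_sum[OF assms(2), of I f]
    unfolding linear_on_subspace_def by blast
  then show ?case using insert by simp
next
  \<comment> \<open>A sum over an infinite index set is 0, so this case only needs
    \<open>L 0 = 0\<close>.\<close>
  case (infinite I)
  have "L (0 *\<^sub>R 0) = 0 *\<^sub>R L 0"
    using assms(1,2) subspace_0 unfolding linear_on_subspace_def by blast
  then show ?case using infinite by simp
next
  case empty
  have "L (0 *\<^sub>R 0) = 0 *\<^sub>R L 0"
    using assms(1,2) subspace_0 unfolding linear_on_subspace_def by blast
  then show ?case by simp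
qed

section \<open>Smooth functions on a manifold and their extension from charts\<close>

locale smooth_manifold =
  fixes A :: "('a::{t2_space, second_countable_topology}, 'n::finite) chart set"
  assumes atlas: "smooth_atlas A"
begin

lemma is_chart: "(U, c) \<in> A \<Longrightarrow> is_chart (U, c)"
  using atlas by (auto simp: smooth_atlas_def)

lemma open_chart: "(U, c) \<in> A \<Longrightarrow> open U" "(U, c) \<in> A \<Longrightarrow> open (c ` U)"
  using is_chart by (auto simp: is_chart_def)

lemma chart_around: obtains U c where "(U, c) \<in> A" "p \<in> U"
  using atlas unfolding smooth_atlas_def by blast

lemma smooth_fun_const: "(\<lambda>q. r) \<in> smooth_funs A"
  by (auto simp: smooth_funs_def smooth_on_def comp_def intro!: Ck_on_const open_chart)

lemma smooth_fun_add: "f \<in> smooth_funs A \<Longrightarrow> h \<in> smooth_funs A \<Longrightarrow> f + h \<in> smooth_funs A"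
  by (auto simp: smooth_funs_def smooth_on_def comp_def intro!: Ck_on_add open_chart)

lemma smooth_fun_mult: "f \<in> smooth_funs A \<Longrightarrow> h \<in> smooth_funs A \<Longrightarrow> f * h \<in> smooth_funs A"
  by (auto simp: smooth_funs_def smooth_on_def comp_def intro!: Ck_on_mult open_chart)

lemma smooth_fun_scaleR: "f \<in> smooth_funs A \<Longrightarrow> r *\<^sub>R f \<in> smooth_funs A"
  using smooth_fun_mult[OF smooth_fun_const[of r], of f] by (simp add: times_fun_def scaleR_fun_def)

lemma subspace_smooth_funs: "subspace (smooth_funs A)"
  using smooth_fun_const[of 0] smooth_fun_add smooth_fun_scaleR
  by (auto simp: subspace_def zero_fun_def)

lemma smooth_fun_diff: "f \<in> smooth_funs A \<Longrightarrow> h \<in> smooth_funs A \<Longrightarrow> f - h \<in> smooth_funs A"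
  using subspace_smooth_funs by (rule subspace_diff)

text \<open>The preimage \<open>L\<close> of \<open>K\<close> is compact, hence closed in the
  Hausdorff space. Any chart domain \<open>V\<close> is thus covered by two open sets: on
  \<open>U \<inter> V\<close> the extension is \<open>G\<close> after a transition map, and on
  \<open>V - L\<close> it is 0.\<close>

lemma extend_from_chart:
  assumes "(U, c) \<in> A" "compact K" "K \<subseteq> c ` U" "\<And>k. Ck_on k (c ` U) G"
    and "\<And>y. y \<in> c ` U - K \<Longrightarrow> G y = 0"
  shows "(\<lambda>q. if q \<in> U then G (c q) else 0) \<in> smooth_funs A" (is "?F \<in> _")
proof -
  have "Ck_on k (d ` V) (?F \<circ> inv_into V d)" if Vd: "(V, d) \<in> A" for V d k
  proof -
    define L where "L = inv_into U c ` K"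
    have "compact L" unfolding L_def
      using is_chart[OF assms(1)] assms(2,3)
      by (intro compact_continuous_image) (auto simp: is_chart_def homeomorphism_def intro: continuous_on_subset)
    then have "closed L" by (rule compact_imp_closed)
    have "L \<subseteq> U" using assms(3) by (auto simp: L_def intro: inv_into_into)
    have o1: "open (d ` (U \<inter> V))" and o2: "open (d ` (V - L))"
      using open_chart[OF assms(1)] open_chart[OF Vd] \<open>closed L\<close>
      by (auto intro!: chart_open_image[OF is_chart[OF Vd]])
    have "Ck_on k (d ` (U \<inter> V)) (?F \<circ> inv_into V d)"
    proof (rule Ck_on_cong[OF o1])
      show "Ck_on k (d ` (U \<inter> V)) (\<lambda>x. G ((c \<circ> inv_into V d) x))"
      proof (rule Ck_on_compose[OF o1 _ assms(4)])
        show "(c \<circ> inv_into V d) ` d ` (U \<inter> V) \<subseteq> c ` U"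
          using chart_inverse[OF is_chart[OF Vd]] by auto
        have "smooth_on (d ` (V \<inter> U)) (c \<circ> inv_into V d)"
          using atlas assms(1) Vd unfolding smooth_atlas_def by blast
        then show "Ck_on k (d ` (U \<inter> V)) (c \<circ> inv_into V d)"
          by (simp add: smooth_on_def Int_commute)
      qed
    qed (use chart_inverse[OF is_chart[OF Vd]] in auto)
    moreover have "Ck_on k (d ` (V - L)) (?F \<circ> inv_into V d)"
    proof (rule Ck_on_cong[OF o2 _ Ck_on_const[OF o2, of k 0]])
      fix x assume "x \<in> d ` (V - L)"
      then obtain q where q: "q \<in> V" "q \<notin> L" "x = d q" by auto
      have "G (c q) = 0" if "q \<in> U"
        using q that chart_inverse(1)[OF is_chart[OF assms(1)] that]
        by (intro assms(5)) (auto simp: L_def image_iff)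
      then show "0 = (?F \<circ> inv_into V d) x"
        using q chart_inverse[OF is_chart[OF Vd]] by auto
    qed
    moreover have "d ` V = d ` (U \<inter> V) \<union> d ` (V - L)"
      using \<open>L \<subseteq> U\<close> by auto
    ultimately show ?thesis using Ck_on_Un[OF o1 o2] by simp
  qed
  then show ?thesis by (auto simp: smooth_funs_def smooth_on_def)
qed

lemma bump_extension:
  assumes "(U, c) \<in> A" "p \<in> U"
  obtains r and b :: "real ^ 'n \<Rightarrow> real" where "r > 0" "ball (c p) r \<subseteq> c ` U" "b (c p) = 1" "\<forall>k. Ck_on k UNIV b"
    "\<forall>y. y \<notin> ball (c p) r \<longrightarrow> b y = 0"
    "\<forall>G. (\<forall>k. Ck_on k (ball (c p) r) G) \<longrightarrow>
       (\<lambda>q. if q \<in> U then b (c q) * G (c q) else 0) \<in> smooth_funs A"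
proof -
  obtain r where r: "r > 0" "ball (c p) r \<subseteq> c ` U"
    using open_chart(2)[OF assms(1)] assms(2) by (meson image_eqI openE)
  \<comment> \<open>The bump lives on half the radius, so that the closed ball \<open>?K\<close> is
    a compact set inside the larger ball on which \<open>G\<close> is smooth.\<close>
  obtain b :: "real ^ 'n \<Rightarrow> real" where b: "\<And>k. Ck_on k UNIV b" "b (c p) = 1"
      "\<And>y. y \<notin> ball (c p) (r / 2) \<Longrightarrow> b y = 0"
    using bump_function_exists[of "r / 2" "c p"] r(1) by auto
  let ?K = "cball (c p) (r / 2)"
  have K: "?K \<subseteq> ball (c p) r" using r(1) by auto
  have ext: "(\<lambda>q. if q \<in> U then b (c q) * G (c q) else 0) \<in> smooth_funs A"
    if G: "\<And>k. Ck_on k (ball (c p) r) G" for G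
  proof -
    have o: "open (c ` U - ?K)" using open_chart(2)[OF assms(1)] by auto
    have e: "c ` U = ball (c p) r \<union> (c ` U - ?K)" using K r(2) by auto
    have "Ck_on k (c ` U) (\<lambda>y. b y * G y)" for k
    proof (subst e, rule Ck_on_Un[OF open_ball o])
      show "Ck_on k (ball (c p) r) (\<lambda>y. b y * G y)"
        by (intro Ck_on_mult G open_ball Ck_on_subset[OF b(1)] subset_UNIV)
      show "Ck_on k (c ` U - ?K) (\<lambda>y. b y * G y)"
        by (rule Ck_on_cong[OF o _ Ck_on_const[OF o, of k 0]]) (use b(3) in auto)
    qed
    then show ?thesis
      by (intro extend_from_chart[OF assms(1), of ?K]) (use K r(2) b(3) in auto)
  qed
  have "\<forall>y. y \<notin> ball (c p) r \<longrightarrow> b y = 0" using r(1) b(3) by auto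
  then show ?thesis using that[of r b] r b ext by blast
qed

section \<open>Derivations at a point as coordinate derivatives\<close>

lemma chart_tangent_in_tangent_space:
  assumes "(U, c) \<in> A" "q \<in> U"
  shows "chart_tangent A (U, c) q w \<in> tangent_space A q"
proof -
  let ?D = "\<lambda>f. frechet_derivative (f \<circ> inv_into U c) (at (c q))"
  note der = smooth_fun_frechet[OF _ assms]
  have inv: "inv_into U c (c q) = q"
    using chart_inverse(1)[OF is_chart[OF assms(1)] assms(2)] .
  have add: "?D (f + h) = (\<lambda>w. ?D f w + ?D h w)" if "f \<in> smooth_funs A" "h \<in> smooth_funs A" for f h
    using has_derivative_add[OF der[OF that(1)] der[OF that(2)]]
    by (intro frechet_derivative_at[symmetric]) (simp add: comp_def)
  have scale: "?D (r *\<^sub>R f) = (\<lambda>w. r *\<^sub>R ?D f w)" if "f \<in> smooth_funs A" for f r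
    using has_derivative_scaleR_right[OF der[OF that], of r]
    by (intro frechet_derivative_at[symmetric]) (simp add: comp_def)
  have mult: "?D (f * h) = (\<lambda>w. f q * ?D h w + ?D f w * h q)"
    if "f \<in> smooth_funs A" "h \<in> smooth_funs A" for f h
    using has_derivative_mult[OF der[OF that(1)] der[OF that(2)]]
    by (intro frechet_derivative_at[symmetric]) (simp add: comp_def inv)
  show ?thesis
    using smooth_fun_add smooth_fun_mult smooth_fun_scaleR
    by (simp add: tangent_space_def chart_tangent_def linear_on_subspace_def add scale mult)
qed

lemma linear_chart_tangent:
  assumes "(U, c) \<in> A" "q \<in> U"
  shows "linear (chart_tangent A (U, c) q)"
proof (rule linearI)
  note lin = has_derivative_linear[OF smooth_fun_frechet[OF _ assms]]
  show "chart_tangent A (U, c) q (v + w) = chart_tangent A (U, c) q v + chart_tangent A (U, c) q w" for v w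
    by (auto simp: chart_tangent_def fun_eq_iff linear_add[OF lin])
  show "chart_tangent A (U, c) q (r *\<^sub>R v) = r *\<^sub>R chart_tangent A (U, c) q v" for r v
    by (auto simp: chart_tangent_def fun_eq_iff linear_cmul[OF lin])
qed

lemma tangent_add: "v \<in> tangent_space A p \<Longrightarrow> f \<in> smooth_funs A \<Longrightarrow> h \<in> smooth_funs A \<Longrightarrow> v (f + h) = v f + v h"
  by (simp add: tangent_space_def linear_on_subspace_def)

lemma tangent_scaleR: "v \<in> tangent_space A p \<Longrightarrow> f \<in> smooth_funs A \<Longrightarrow> v (r *\<^sub>R f) = r * v f"
  by (simp add: tangent_space_def linear_on_subspace_def)

lemma tangent_mult:
  "v \<in> tangent_space A p \<Longrightarrow> f \<in> smooth_funs A \<Longrightarrow> h \<in> smooth_funs A \<Longrightarrow> v (f * h) = v f * h p + f p * v h"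
  by (simp add: tangent_space_def)

text \<open>The Leibniz rule for 1 * 1 = 1 gives v(1) = 2 v(1).\<close>

lemma tangent_const:
  assumes "v \<in> tangent_space A p"
  shows "v (\<lambda>q. r) = 0"
proof -
  have "v ((\<lambda>q. 1) * (\<lambda>q. 1)) = v (\<lambda>q. 1) * 1 + 1 * v (\<lambda>q. 1)"
    by (rule tangent_mult[OF assms smooth_fun_const smooth_fun_const])
  then have "v (\<lambda>q. 1) = 0" by (simp add: times_fun_def)
  then show ?thesis
    using tangent_scaleR[OF assms smooth_fun_const, of r 1] by (simp add: scaleR_fun_def)
qed

lemma tangent_diff:
  assumes "v \<in> tangent_space A p" "f \<in> smooth_funs A" "h \<in> smooth_funs A"
  shows "v (f - h) = v f - v h"
  using tangent_add[OF assms(1) smooth_fun_diff[OF assms(2,3)] assms(3)] by simp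

text \<open>The components of \<open>v\<close> in the chart are its values on the coordinate functions, cut off away
  from \<open>p\<close>; Hadamard's lemma shows that \<open>v\<close> is determined by them.\<close>

lemma tangent_space_eq_range:
  assumes "(U, c) \<in> A" "p \<in> U"
  shows "tangent_space A p = range (chart_tangent A (U, c) p)" "inj (chart_tangent A (U, c) p)"
proof -
  let ?T = "chart_tangent A (U, c) p"
  obtain r and b :: "real ^ 'n \<Rightarrow> real" where r: "r > 0" "ball (c p) r \<subseteq> c ` U"
    and b: "b (c p) = 1" "\<forall>k. Ck_on k UNIV b" "\<forall>y. y \<notin> ball (c p) r \<longrightarrow> b y = 0"
    and ext: "\<forall>G. (\<forall>k. Ck_on k (ball (c p) r) G) \<longrightarrow>
       (\<lambda>q. if q \<in> U then b (c q) * G (c q) else 0) \<in> smooth_funs A"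
    by (rule bump_extension[OF assms])
  define E where "E = (\<lambda>G q. if q \<in> U then b (c q) * G (c q) else 0)"
  have E: "(\<And>k. Ck_on k (ball (c p) r) G) \<Longrightarrow> E G \<in> smooth_funs A" for G
    using ext unfolding E_def by blast
  have Ep: "E G p = G (c p)" for G using assms(2) b(1) by (simp add: E_def)
  let ?x = "\<lambda>e. E (\<lambda>y. (y - c p) \<bullet> e)"
  have x: "?x e \<in> smooth_funs A" for e
  proof (rule E)
    fix k
    have "Ck_on k (ball (c p) r) (\<lambda>y. y \<bullet> e + - (c p \<bullet> e))"
      by (intro Ck_on_add Ck_on_const Ck_on_bounded_linear bounded_linear_inner_left open_ball)
    then show "Ck_on k (ball (c p) r) (\<lambda>y. (y - c p) \<bullet> e)" by (simp add: inner_diff_left)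
  qed
  have one: "E (\<lambda>y. 1) \<in> smooth_funs A" by (intro E Ck_on_const open_ball)
  have "v \<in> range ?T" if v: "v \<in> tangent_space A p" for v
  proof -
    have sumv: "v (\<Sum>i\<in>I. f i) = (\<Sum>i\<in>I. v (f i))" if "\<And>i. i \<in> I \<Longrightarrow> f i \<in> smooth_funs A" for f and I :: "'i set"
      using v by (intro sum_on_subspace[OF _ subspace_smooth_funs that]) (auto simp: tangent_space_def)
    have "v f = ?T (\<Sum>e\<in>Basis. v (?x e) *\<^sub>R e) f" for f
    proof (cases "f \<in> smooth_funs A")
      case f: True
      let ?F = "f \<circ> inv_into U c"
      let ?g = "\<lambda>e. segment_average 0 (\<lambda>y. frechet_derivative ?F (at y) e) (c p)"
      have F: "Ck_on k (ball (c p) r) ?F" for k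
        by (rule Ck_on_subset[OF smooth_funsD[OF f assms(1)] r(2)])
      have g: "E (?g e) \<in> smooth_funs A" for e
        using F[of "Suc _"] by (intro E Ck_on_segment_average) simp
      let ?u = "f - (\<lambda>q. f p)"
      have u: "?u \<in> smooth_funs A" by (intro smooth_fun_diff smooth_fun_const f)
      \<comment> \<open>Hadamard's expansion of f - f(p), made global: the cut-off enters squared
        because both factors of each summand on the right carry it.\<close>
      have "(E (\<lambda>y. 1) * E (\<lambda>y. 1)) * ?u = (\<Sum>e\<in>Basis. ?x e * E (?g e))"
      proof
        fix q
        consider "q \<notin> U" | "q \<in> U" "c q \<notin> ball (c p) r" | "q \<in> U" "c q \<in> ball (c p) r" by blast
        then show "((E (\<lambda>y. 1) * E (\<lambda>y. 1)) * ?u) q = (\<Sum>e\<in>Basis. ?x e * E (?g e)) q"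
        proof cases
          case 3
          have "f q - f p = (\<Sum>e\<in>Basis. ((c q - c p) \<bullet> e) * ?g e (c q))"
            using hadamard[OF F 3(2)] chart_inverse(1)[OF is_chart[OF assms(1)]] 3(1) assms(2) by simp
          then show ?thesis using 3(1)
            by (simp add: E_def sum_fun_apply sum_distrib_left mult_ac)
        qed (simp_all add: E_def sum_fun_apply b(3))
      qed
      then have "v ((E (\<lambda>y. 1) * E (\<lambda>y. 1)) * ?u) = (\<Sum>e\<in>Basis. v (?x e * E (?g e)))"
        using sumv[of Basis "\<lambda>e. ?x e * E (?g e)"] smooth_fun_mult[OF x g] by simp
      \<comment> \<open>At \<open>p\<close> the cut-off is 1 and \<open>?u\<close> is 0, so the
        derivative of the cut-off drops out.\<close>
      moreover have "v ((E (\<lambda>y. 1) * E (\<lambda>y. 1)) * ?u) = v f"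
        using tangent_mult[OF v smooth_fun_mult[OF one one] u]
        by (simp add: Ep tangent_diff[OF v f smooth_fun_const] tangent_const[OF v])
      \<comment> \<open>The coordinate \<open>?x e\<close> vanishes at \<open>p\<close>, and the
        average taken at the centre is the partial derivative itself.\<close>
      moreover have "v (?x e * E (?g e)) = v (?x e) * frechet_derivative ?F (at (c p)) e" for e
        using tangent_mult[OF v x g] by (simp add: Ep segment_average_center)
      moreover have "linear (frechet_derivative ?F (at (c p)))"
        using smooth_fun_frechet[OF f assms] by (rule has_derivative_linear)
      ultimately show ?thesis using f
        by (simp add: chart_tangent_def linear_sum linear_cmul)
    next
      case False
      then show ?thesis using v by (simp add: tangent_space_def chart_tangent_def)
    qed
    then show ?thesis by blast
  qed
  then show "tangent_space A p = range ?T"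
    using chart_tangent_in_tangent_space[OF assms] by auto
  \<comment> \<open>Injectivity: testing on the cut-off coordinates recovers the components of
    \<open>w\<close>, since \<open>b\<close> is 1 and y - c(p) is 0 at the base point.\<close>
  have "?T w (?x e) = w \<bullet> e" for w e
  proof -
    have "(b has_derivative frechet_derivative b (at (c p))) (at (c p))"
      using b(2) by (intro Ck_on_1_derivative[of UNIV]) auto
    moreover have "((\<lambda>y. (y - c p) \<bullet> e) has_derivative (\<lambda>w. w \<bullet> e)) (at (c p))"
      by (auto intro!: derivative_eq_intros)
    ultimately have "((\<lambda>y. b y * ((y - c p) \<bullet> e)) has_derivative (\<lambda>w. w \<bullet> e)) (at (c p))"
      using has_derivative_mult b(1) by fastforce
    then have "((?x e \<circ> inv_into U c) has_derivative (\<lambda>w. w \<bullet> e)) (at (c p))"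
    proof (rule has_derivative_transform_within_open[OF _ open_chart(2)[OF assms(1)]])
      show "c p \<in> c ` U" using assms(2) by simp
    qed (use chart_inverse[OF is_chart[OF assms(1)]] in \<open>auto simp: E_def\<close>)
    from frechet_derivative_at[OF this] show ?thesis
      using x by (simp add: chart_tangent_def) metis
  qed
  then have "w = w'" if "?T w = ?T w'" for w w'
    using that by (metis vector_eq_rdot)
  then show "inj ?T" by (auto intro: injI)
qed

lemma subspace_tangent_space: "subspace (tangent_space A p)"
proof -
  obtain U c where "(U, c) \<in> A" "p \<in> U" using chart_around .
  then show ?thesis
    using tangent_space_eq_range(1) linear_subspace_image[OF linear_chart_tangent subspace_UNIV] by metis
qed

lemma tangent_basis_exists:
  obtains B where "finite B" "card B = CARD('n)" "independent B" "span B = tangent_space A p"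
proof -
  obtain U c where Uc: "(U, c) \<in> A" "p \<in> U" using chart_around .
  let ?T = "chart_tangent A (U, c) p" and ?B = "Basis :: (real ^ 'n) set"
  show ?thesis
  proof
    show "card (?T ` ?B) = CARD('n)"
      using tangent_space_eq_range(2)[OF Uc] by (subst card_image) (auto intro: inj_on_subset)
    show "independent (?T ` ?B)"
      using tangent_space_eq_range(2)[OF Uc]
      by (intro linear_independent_injective_image linear_chart_tangent[OF Uc] independent_Basis)
        (auto intro: inj_on_subset)
    show "span (?T ` ?B) = tangent_space A p"
      using linear_span_image[OF linear_chart_tangent[OF Uc], of ?B] tangent_space_eq_range(1)[OF Uc] by simp
  qed simp
qed

text \<open>Needed because \<open>endo_trace\<close> works in an unspecified basis obtained by
  choice.\<close>

lemma tangent_basis_card: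
  assumes "independent B" "span B = tangent_space A p"
  shows "finite B" "card B = CARD('n)"
proof -
  obtain B' where B': "finite B'" "card B' = CARD('n)" "independent B'" "span B' = tangent_space A p"
    using tangent_basis_exists .
  have 1: "finite B \<and> card B \<le> card B'"
    using assms B' span_superset[of B] by (intro independent_span_bound) auto
  moreover have "card B' \<le> card B"
    using 1 assms B' span_superset[of B'] by (metis independent_span_bound)
  ultimately show "finite B" "card B = CARD('n)" using B'(2) by auto
qed

text \<open>Take the field with constant coordinate components \<open>w\<close> and multiply it by a
  bump that is 1 at \<open>p\<close>.\<close>

lemma vector_field_extension:
  assumes "v \<in> tangent_space A p"
  obtains X where "X \<in> vector_fields A" "X p = v"
proof -
  obtain U c where Uc: "(U, c) \<in> A" "p \<in> U" using chart_around .
  obtain w where w: "v = chart_tangent A (U, c) p w"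
    using tangent_space_eq_range(1)[OF Uc] assms by auto
  obtain r and b :: "real ^ 'n \<Rightarrow> real" where r: "r > 0" "ball (c p) r \<subseteq> c ` U"
    and b: "b (c p) = 1" "\<forall>k. Ck_on k UNIV b" "\<forall>y. y \<notin> ball (c p) r \<longrightarrow> b y = 0"
    and ext: "\<forall>G. (\<forall>k. Ck_on k (ball (c p) r) G) \<longrightarrow>
       (\<lambda>q. if q \<in> U then b (c q) * G (c q) else 0) \<in> smooth_funs A"
    by (rule bump_extension[OF Uc])
  define X where "X = (\<lambda>q. if q \<in> U then b (c q) *\<^sub>R chart_tangent A (U, c) q w else 0)"
  have "X q \<in> tangent_space A q" for q
    using chart_tangent_in_tangent_space[OF Uc(1)] subspace_tangent_space
    by (auto simp: X_def intro: subspace_mul subspace_0)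
  moreover have "(\<lambda>q. X q f) \<in> smooth_funs A" if f: "f \<in> smooth_funs A" for f
  proof -
    have "Ck_on k (c ` U) (\<lambda>y. frechet_derivative (f \<circ> inv_into U c) (at y) w)" for k
      using smooth_funsD[OF f Uc(1), of "Suc k"] by simp
    with ext Ck_on_subset[OF _ r(2)] have
      "(\<lambda>q. if q \<in> U then b (c q) * frechet_derivative (f \<circ> inv_into U c) (at (c q)) w else 0) \<in> smooth_funs A" by blast
    moreover have "(\<lambda>q. X q f) =
        (\<lambda>q. if q \<in> U then b (c q) * frechet_derivative (f \<circ> inv_into U c) (at (c q)) w else 0)"
      by (auto simp: X_def chart_tangent_def f)
    ultimately show ?thesis by simp
  qed
  ultimately have "X \<in> vector_fields A" by (auto simp: vector_fields_def)
  then show thesis using that[of X] Uc(2) b w by (simp add: X_def)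
qed

text \<open>The scalar part contributes \<open>a\<close> once per basis vector, and a rank-one map
  with form \<omega> and vector u has trace \<omega>(u). The curvature endomorphisms traced below
  have this shape.\<close>

lemma endo_trace_scale_plus_rank_two:
  assumes L: "\<And>v. v \<in> tangent_space A p \<Longrightarrow> L v = a *\<^sub>R v + \<omega> v *\<^sub>R u + \<omega>' v *\<^sub>R u'"
    and \<omega>: "linear_on_subspace (tangent_space A p) \<omega>" and u: "u \<in> tangent_space A p"
    and \<omega>': "linear_on_subspace (tangent_space A p) \<omega>'" and u': "u' \<in> tangent_space A p"
  shows "endo_trace (tangent_space A p) L = a * CARD('n) + \<omega> u + \<omega>' u'"
proof -
  define B where "B = (SOME B. independent B \<and> span B = tangent_space A p)"
  have "\<exists>B. independent B \<and> span B = tangent_space A p" using tangent_basis_exists by metis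
  from someI_ex[OF this] have B: "independent B" "span B = tangent_space A p"
    by (auto simp: B_def)
  note fin = tangent_basis_card[OF B]
  have BT: "b \<in> tangent_space A p" if "b \<in> B" for b using B(2) span_superset that by blast
  \<comment> \<open>By linearity the sum is \<omega> applied to the basis expansion of
    \<open>u\<close>.\<close>
  have rank_one: "(\<Sum>b\<in>B. \<omega> b * representation B u b) = \<omega> u"
    if \<omega>: "linear_on_subspace (tangent_space A p) \<omega>" and u: "u \<in> tangent_space A p" for \<omega> u
  proof -
    have "(\<Sum>b\<in>B. \<omega> b * representation B u b) = (\<Sum>b\<in>B. \<omega> (representation B u b *\<^sub>R b))"
      using \<omega> BT by (intro sum.cong) (auto simp: linear_on_subspace_def)
    also have "\<dots> = \<omega> (\<Sum>b\<in>B. representation B u b *\<^sub>R b)"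
      using BT by (intro sum_on_subspace[OF \<omega> subspace_tangent_space, symmetric])
        (auto intro: subspace_mul subspace_tangent_space)
    also have "(\<Sum>b\<in>B. representation B u b *\<^sub>R b) = u"
      using sum_representation_eq[OF B(1), of u B] u B(2) fin(1) by simp
    finally show ?thesis .
  qed
  have "endo_trace (tangent_space A p) L = (\<Sum>b\<in>B. representation B (L b) b)"
    by (simp add: endo_trace_def B_def Let_def)
  also have "\<dots> = (\<Sum>b\<in>B. a + \<omega> b * representation B u b + \<omega>' b * representation B u' b)"
  proof (rule sum.cong[OF refl])
    fix b assume b: "b \<in> B"
    have m: "r *\<^sub>R w \<in> span B" if "w \<in> span B" for r and w :: "'a tangent" using that by (rule span_scale)
    have s: "b \<in> span B" "u \<in> span B" "u' \<in> span B" using u u' B(2) span_base[OF b] by auto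
    have "representation B (L b) b =
        a * representation B b b + \<omega> b * representation B u b + \<omega>' b * representation B u' b"
      unfolding L[OF BT[OF b]]
      by (simp only: representation_add[OF B(1) m[OF s(3)] span_add[OF m[OF s(1)] m[OF s(2)]]]
          representation_add[OF B(1) m[OF s(2)] m[OF s(1)]]
          representation_scale[OF B(1) s(1)] representation_scale[OF B(1) s(2)]
          representation_scale[OF B(1) s(3)])
    then show "representation B (L b) b = a + \<omega> b * representation B u b + \<omega>' b * representation B u' b"
      using representation_basis[OF B(1) b] by simp
  qed
  also have "\<dots> = a * CARD('n) + \<omega> u + \<omega>' u'"
    using fin rank_one[OF \<omega> u] rank_one[OF \<omega>' u'] by (simp add: sum.distrib)
  finally show ?thesis .
qed

end

section \<open>Curvature of Kenmotsu manifolds\<close>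

context smooth_manifold
begin

abbreviation "VF \<equiv> vector_fields A"

lemma vf_tangent [simp]: "X \<in> VF \<Longrightarrow> X p \<in> tangent_space A p"
  by (simp add: vector_fields_def)

lemma vf_smooth: "X \<in> VF \<Longrightarrow> f \<in> smooth_funs A \<Longrightarrow> (\<lambda>p. X p f) \<in> smooth_funs A"
  unfolding vector_fields_def by blast

lemma tangent_space_closed [simp]:
  "u \<in> tangent_space A p \<Longrightarrow> v \<in> tangent_space A p \<Longrightarrow> u + v \<in> tangent_space A p"
  "u \<in> tangent_space A p \<Longrightarrow> v \<in> tangent_space A p \<Longrightarrow> u - v \<in> tangent_space A p"
  "v \<in> tangent_space A p \<Longrightarrow> - v \<in> tangent_space A p"
  "v \<in> tangent_space A p \<Longrightarrow> r *\<^sub>R v \<in> tangent_space A p"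
  "0 \<in> tangent_space A p"
  using subspace_add[OF subspace_tangent_space] subspace_diff[OF subspace_tangent_space]
    subspace_neg[OF subspace_tangent_space] subspace_mul[OF subspace_tangent_space]
    subspace_0[OF subspace_tangent_space]
  by blast+

lemma vf_scale [simp]:
  assumes "f \<in> smooth_funs A" "X \<in> VF"
  shows "(\<lambda>p. f p *\<^sub>R X p) \<in> VF"
proof -
  have "(\<lambda>p. (f p *\<^sub>R X p) h) \<in> smooth_funs A" if "h \<in> smooth_funs A" for h
    using smooth_fun_mult[OF assms(1) vf_smooth[OF assms(2) that]] by (simp add: times_fun_def)
  then show ?thesis
    unfolding vector_fields_def using tangent_space_closed(4)[OF vf_tangent[OF assms(2)]] by blast
qed

lemma vf_add [simp]:
  assumes "X \<in> VF" "Y \<in> VF"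
  shows "X + Y \<in> VF"
proof -
  have "(\<lambda>p. (X + Y) p h) \<in> smooth_funs A" if "h \<in> smooth_funs A" for h
    using smooth_fun_add[OF vf_smooth[OF assms(1) that] vf_smooth[OF assms(2) that]]
    by (simp add: plus_fun_def)
  moreover have "(X + Y) p \<in> tangent_space A p" for p
    using tangent_space_closed(1)[OF vf_tangent[OF assms(1)] vf_tangent[OF assms(2)]] by simp
  ultimately show ?thesis unfolding vector_fields_def by blast
qed

lemma vf_minus [simp]:
  assumes "X \<in> VF"
  shows "- X \<in> VF"
proof -
  have "- X = (\<lambda>p. (- 1) *\<^sub>R X p)" by (rule ext) simp
  then show ?thesis using vf_scale[OF smooth_fun_const assms, of "- 1"] by metis
qed

lemma vf_diff [simp]: "X \<in> VF \<Longrightarrow> Y \<in> VF \<Longrightarrow> X - Y \<in> VF"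
  using vf_add[OF _ vf_minus, of X Y] by simp

lemma vf_zero [simp]: "0 \<in> VF"
proof -
  have "(\<lambda>p. (0 :: 'a field) p f) \<in> smooth_funs A" for f
    using smooth_fun_const[of 0] by simp
  moreover have "(0 :: 'a field) p \<in> tangent_space A p" for p by simp
  ultimately show ?thesis unfolding vector_fields_def by blast
qed

lemma tangent_plus:
  "v \<in> tangent_space A p \<Longrightarrow> f \<in> smooth_funs A \<Longrightarrow> h \<in> smooth_funs A \<Longrightarrow> v (\<lambda>q. f q + h q) = v f + v h"
  using tangent_add by (simp add: plus_fun_def)

lemma tangent_minus:
  "v \<in> tangent_space A p \<Longrightarrow> f \<in> smooth_funs A \<Longrightarrow> h \<in> smooth_funs A \<Longrightarrow> v (\<lambda>q. f q - h q) = v f - v h"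
  using tangent_diff by (simp add: fun_diff_def)

lemma tangent_cmul:
  "v \<in> tangent_space A p \<Longrightarrow> f \<in> smooth_funs A \<Longrightarrow> v (\<lambda>q. r * f q) = r * v f"
  using tangent_scaleR by (simp add: scaleR_fun_def)

lemma lie_bracket_apply:
  "f \<in> smooth_funs A \<Longrightarrow> lie_bracket A X Y p f = X p (\<lambda>q. Y q f) - Y p (\<lambda>q. X q f)"
  by (simp add: lie_bracket_def)

text \<open>On a smooth function each nested bracket expands into four triple derivatives, and the
  twelve terms cancel in pairs; on other functions all brackets are 0 by convention.\<close>

lemma lie_jacobi:
  assumes "X \<in> VF" "Y \<in> VF" "Z \<in> VF"
  shows "lie_bracket A X (lie_bracket A Y Z) + lie_bracket A Y (lie_bracket A Z X)
    + lie_bracket A Z (lie_bracket A X Y) = 0"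
proof (intro ext)
  fix p f
  have nested: "lie_bracket A X (lie_bracket A Y Z) p f =
      X p (\<lambda>q. Y q (\<lambda>q. Z q f)) - X p (\<lambda>q. Z q (\<lambda>q. Y q f))
      - (Y p (\<lambda>q. Z q (\<lambda>q. X q f)) - Z p (\<lambda>q. Y q (\<lambda>q. X q f)))"
    if f: "f \<in> smooth_funs A" and VF: "X \<in> VF" "Y \<in> VF" "Z \<in> VF" for X Y Z
    by (simp only: lie_bracket_apply[OF f] lie_bracket_apply[OF vf_smooth[OF VF(1) f]]
        tangent_minus[OF vf_tangent[OF VF(1)] vf_smooth[OF VF(2) vf_smooth[OF VF(3) f]]
          vf_smooth[OF VF(3) vf_smooth[OF VF(2) f]]])
  show "(lie_bracket A X (lie_bracket A Y Z) + lie_bracket A Y (lie_bracket A Z X)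
    + lie_bracket A Z (lie_bracket A X Y)) p f = 0 p f"
  proof (cases "f \<in> smooth_funs A")
    case True
    show ?thesis
      unfolding plus_fun_apply zero_fun_apply
      using nested[OF True assms] nested[OF True assms(2,3,1)] nested[OF True assms(3,1,2)] by linarith
  next
    case False
    then show ?thesis by (simp add: lie_bracket_def)
  qed
qed

end

section \<open>The Levi-Civita connection and its curvature\<close>

locale riemannian_manifold = smooth_manifold A
  for A :: "('a::{t2_space, second_countable_topology}, 'n::finite) chart set" +
  fixes g :: "'a metric_tensor" and D :: "'a connection"
  assumes metric: "riemannian_metric A g" and levi_civita: "levi_civita A g D"
begin

lemma metric_linear_right:
  assumes "u \<in> tangent_space A p" "v \<in> tangent_space A p"
  shows "w \<in> tangent_space A p \<Longrightarrow> g p u (v + w) = g p u v + g p u w"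
    "w \<in> tangent_space A p \<Longrightarrow> g p u (v - w) = g p u v - g p u w"
    "g p u (- v) = - g p u v"
    "g p u (r *\<^sub>R v) = r * g p u v"
    "g p u 0 = 0"
proof -
  have lin: "linear_on_subspace (tangent_space A p) (g p u)"
    using metric assms(1) by (simp add: riemannian_metric_def)
  show s: "g p u (r *\<^sub>R v) = r * g p u v" for r
    using lin assms(2) by (simp add: linear_on_subspace_def)
  show "g p u (- v) = - g p u v" using s[of "-1"] by simp
  show "g p u 0 = 0" using s[of 0] by simp
  show a: "g p u (v + w) = g p u v + g p u w" if "w \<in> tangent_space A p" for w
    using lin assms(2) that by (simp add: linear_on_subspace_def)
  show "g p u (v - w) = g p u v - g p u w" if w: "w \<in> tangent_space A p"
  proof -
    have "g p u ((v - w) + w) = g p u (v - w) + g p u w"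
      using lin assms(2) w by (simp only: linear_on_subspace_def tangent_space_closed)
    then show ?thesis by simp
  qed
qed

lemma metric_sym: "u \<in> tangent_space A p \<Longrightarrow> v \<in> tangent_space A p \<Longrightarrow> g p u v = g p v u"
  using metric by (simp add: riemannian_metric_def)

lemma metric_linear_left:
  assumes "u \<in> tangent_space A p" "v \<in> tangent_space A p"
  shows "w \<in> tangent_space A p \<Longrightarrow> g p (v + w) u = g p v u + g p w u"
    "w \<in> tangent_space A p \<Longrightarrow> g p (v - w) u = g p v u - g p w u"
    "g p (- v) u = - g p v u"
    "g p (r *\<^sub>R v) u = r * g p v u"
    "g p 0 u = 0"
  using metric_linear_right[OF assms] assms by (simp_all add: metric_sym[of _ p u])

lemmas metric_linear = metric_linear_left metric_linear_right

lemma metric_smooth [simp]: "X \<in> VF \<Longrightarrow> Y \<in> VF \<Longrightarrow> (\<lambda>p. g p (X p) (Y p)) \<in> smooth_funs A"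
  using metric by (simp add: riemannian_metric_def)

text \<open>Extending \<open>u\<close> itself to a field gives g(u,u) = 0, against positive
  definiteness.\<close>

lemma metric_nondegenerate:
  assumes "u \<in> tangent_space A p" "\<And>W. W \<in> VF \<Longrightarrow> g p u (W p) = 0"
  shows "u = 0"
proof -
  obtain W where "W \<in> VF" "W p = u" using vector_field_extension[OF assms(1)] .
  then have "g p u u = 0" using assms(2) by auto
  then show ?thesis using metric assms(1) unfolding riemannian_metric_def by (metis less_irrefl)
qed

lemma connection:
  shows vf_D [simp]: "X \<in> VF \<Longrightarrow> Y \<in> VF \<Longrightarrow> D X Y \<in> VF"
    and D_add_left: "X \<in> VF \<Longrightarrow> Y \<in> VF \<Longrightarrow> Z \<in> VF \<Longrightarrow> D (X + Y) Z = D X Z + D Y Z"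
    and D_add_right: "X \<in> VF \<Longrightarrow> Y \<in> VF \<Longrightarrow> Z \<in> VF \<Longrightarrow> D X (Y + Z) = D X Y + D X Z"
    and D_leibniz: "X \<in> VF \<Longrightarrow> Y \<in> VF \<Longrightarrow> f \<in> smooth_funs A \<Longrightarrow>
      D X (\<lambda>p. f p *\<^sub>R Y p) = (\<lambda>p. X p f *\<^sub>R Y p + f p *\<^sub>R D X Y p)"
  using levi_civita by (simp_all add: levi_civita_def linear_connection_def)

lemma torsion_free: "X \<in> VF \<Longrightarrow> Y \<in> VF \<Longrightarrow> lie_bracket A X Y = D X Y - D Y X"
  using levi_civita by (simp add: levi_civita_def)

lemma metric_compatible:
  "X \<in> VF \<Longrightarrow> Y \<in> VF \<Longrightarrow> Z \<in> VF \<Longrightarrow>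
    X p (\<lambda>q. g q (Y q) (Z q)) = g p (D X Y p) (Z p) + g p (Y p) (D X Z p)"
  using levi_civita by (simp add: levi_civita_def)

lemma vf_lie [simp]: "X \<in> VF \<Longrightarrow> Y \<in> VF \<Longrightarrow> lie_bracket A X Y \<in> VF"
  by (simp add: torsion_free)

lemma D_diff_right: "X \<in> VF \<Longrightarrow> Y \<in> VF \<Longrightarrow> Z \<in> VF \<Longrightarrow> D X (Y - Z) = D X Y - D X Z"
  using D_add_right[of X "Y - Z" Z] by simp

lemma D_diff_left: "X \<in> VF \<Longrightarrow> Y \<in> VF \<Longrightarrow> Z \<in> VF \<Longrightarrow> D (X - Y) Z = D X Z - D Y Z"
  using D_add_left[of "X - Y" Y Z] by simp

lemma D_zero: "X \<in> VF \<Longrightarrow> D X 0 = 0" "X \<in> VF \<Longrightarrow> D 0 X = 0"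
  using D_diff_right[of X X X] D_diff_left[of X X X] by simp_all

lemma vf_curvature [simp]: "X \<in> VF \<Longrightarrow> Y \<in> VF \<Longrightarrow> Z \<in> VF \<Longrightarrow> curvature A D X Y Z \<in> VF"
  by (simp add: curvature_def)

text \<open>Both sides of [X,Y] g(Z,W) = XY g(Z,W) - YX g(Z,W) are expanded by metric compatibility.
  The mixed terms g(D_Y Z, D_X W) + g(D_X Z, D_Y W) are symmetric in X and Y and cancel.\<close>

lemma curvature_skew:
  assumes "X \<in> VF" "Y \<in> VF" "Z \<in> VF" "W \<in> VF"
  shows "g p (curvature A D X Y Z p) (W p) = - g p (curvature A D X Y W p) (Z p)"
proof -
  note VF = assms
  have second: "X p (\<lambda>q. Y q (\<lambda>q. g q (Z q) (W q))) =
      g p (D X (D Y Z) p) (W p) + g p (D Y Z p) (D X W p) + g p (D X Z p) (D Y W p) + g p (Z p) (D X (D Y W) p)"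
    if "X \<in> VF" "Y \<in> VF" for X Y
    using that VF(3,4) by (simp add: metric_compatible[OF that(1)] metric_compatible[OF that(2)]
        tangent_plus[OF vf_tangent[OF that(1)]])
  have "lie_bracket A X Y p (\<lambda>q. g q (Z q) (W q)) =
      X p (\<lambda>q. Y q (\<lambda>q. g q (Z q) (W q))) - Y p (\<lambda>q. X q (\<lambda>q. g q (Z q) (W q)))"
    using VF by (simp add: lie_bracket_def)
  moreover have "lie_bracket A X Y p (\<lambda>q. g q (Z q) (W q)) =
      g p (D (lie_bracket A X Y) Z p) (W p) + g p (Z p) (D (lie_bracket A X Y) W p)"
    using VF by (intro metric_compatible) auto
  ultimately show ?thesis using VF
    by (simp add: second curvature_def metric_linear metric_sym[of "Z p" p])
qed

lemma curvature_swap: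
  assumes "X \<in> VF" "Y \<in> VF" "Z \<in> VF"
  shows "curvature A D X Y Z = - curvature A D Y X Z"
  using assms by (simp add: curvature_def torsion_free D_diff_left)

text \<open>Absence of torsion rewrites each nested bracket through \<open>D\<close>; the cyclic sum
  of the results is the cyclic sum of curvatures, and the Jacobi identity makes it vanish.\<close>

lemma bianchi:
  assumes "X \<in> VF" "Y \<in> VF" "Z \<in> VF"
  shows "curvature A D X Y Z + curvature A D Y Z X + curvature A D Z X Y = 0"
proof -
  note VF = assms
  have *: "lie_bracket A X (lie_bracket A Y Z) =
      D X (D Y Z) - D X (D Z Y) - D (lie_bracket A Y Z) X" if "X \<in> VF" "Y \<in> VF" "Z \<in> VF" for X Y Z
    using that torsion_free[of X "lie_bracket A Y Z"] torsion_free[of Y Z] by (simp add: D_diff_right)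
  show ?thesis using lie_jacobi[OF VF] VF
    by (simp add: * curvature_def algebra_simps)
qed

end

section \<open>Kenmotsu structure and Levi-Civita curvature along \<xi>\<close>

locale kenmotsu_manifold = riemannian_manifold A g D
  for A :: "('a::{t2_space, second_countable_topology}, 'n::finite) chart set" and g and D +
  fixes \<phi> :: "'a \<Rightarrow> 'a tangent \<Rightarrow> 'a tangent" and \<xi> :: "'a field" and \<eta> :: "'a \<Rightarrow> 'a tangent \<Rightarrow> real"
  assumes kenmotsu: "kenmotsu A \<phi> \<xi> \<eta> g D"
begin

lemma vf_xi [simp]: "\<xi> \<in> VF"
  using kenmotsu by (simp add: kenmotsu_def)

lemma vf_phi [simp]: "X \<in> VF \<Longrightarrow> (\<lambda>p. \<phi> p (X p)) \<in> VF"
  using kenmotsu by (simp add: kenmotsu_def tensor_field_1_1_def)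

lemma phi_tangent [simp]: "v \<in> tangent_space A p \<Longrightarrow> \<phi> p v \<in> tangent_space A p"
  using kenmotsu by (simp add: kenmotsu_def tensor_field_1_1_def)

lemma phi_linear: "linear_on_subspace (tangent_space A p) (\<phi> p)"
  using kenmotsu by (simp add: kenmotsu_def tensor_field_1_1_def)

lemma eta_linear: "linear_on_subspace (tangent_space A p) (\<eta> p)"
  using kenmotsu by (simp add: kenmotsu_def one_form_def)

lemma eta_smooth [simp]: "X \<in> VF \<Longrightarrow> (\<lambda>p. \<eta> p (X p)) \<in> smooth_funs A"
  using kenmotsu by (simp add: kenmotsu_def one_form_def)

lemma kenmotsu_structure:
  shows phi_xi [simp]: "\<phi> p (\<xi> p) = 0" and eta_xi [simp]: "\<eta> p (\<xi> p) = 1"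
    and phi_phi: "X \<in> VF \<Longrightarrow> \<phi> p (\<phi> p (X p)) = - X p + \<eta> p (X p) *\<^sub>R \<xi> p"
    and eta_phi [simp]: "X \<in> VF \<Longrightarrow> \<eta> p (\<phi> p (X p)) = 0"
    and D_xi_apply: "X \<in> VF \<Longrightarrow> D X \<xi> p = X p - \<eta> p (X p) *\<^sub>R \<xi> p"
    and metric_phi: "X \<in> VF \<Longrightarrow> Y \<in> VF \<Longrightarrow>
      g p (\<phi> p (X p)) (\<phi> p (Y p)) = g p (X p) (Y p) - \<eta> p (X p) * \<eta> p (Y p)"
    and D_phi: "X \<in> VF \<Longrightarrow> Y \<in> VF \<Longrightarrow> D X (\<lambda>q. \<phi> q (Y q)) p - \<phi> p (D X Y p) =
      g p (\<phi> p (X p)) (Y p) *\<^sub>R \<xi> p - \<eta> p (Y p) *\<^sub>R \<phi> p (X p)"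
  using kenmotsu by (simp_all add: kenmotsu_def)

lemma D_xi: "X \<in> VF \<Longrightarrow> D X \<xi> = X - (\<lambda>p. \<eta> p (X p) *\<^sub>R \<xi> p)"
  by (rule ext) (simp add: D_xi_apply)

lemma D_xi_xi [simp]: "D \<xi> \<xi> = 0"
  by (simp add: D_xi fun_eq_iff)

text \<open>With \<xi> as one argument the left side of \<open>metric_phi\<close> vanishes, because
  \<phi> \<xi> = 0.\<close>

lemma metric_xi [simp]: "X \<in> VF \<Longrightarrow> g p (\<xi> p) (X p) = \<eta> p (X p)" "X \<in> VF \<Longrightarrow> g p (X p) (\<xi> p) = \<eta> p (X p)"
  using metric_phi[of \<xi> X p] metric_sym[of "\<xi> p" p "X p"] metric_linear_left(5)[of "\<phi> p (X p)" p 0] by simp_all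

text \<open>The fundamental 2-form of the structure; it is also the coefficient of \<xi> in the
  difference between the semi-symmetric connection and \<open>D\<close>.\<close>

definition fundamental :: "'a field \<Rightarrow> 'a field \<Rightarrow> 'a \<Rightarrow> real" where
  "fundamental X Y p = g p (\<phi> p (X p)) (Y p)"

lemma fundamental_smooth [simp]: "X \<in> VF \<Longrightarrow> Y \<in> VF \<Longrightarrow> fundamental X Y \<in> smooth_funs A"
  using metric_smooth[OF vf_phi] by (simp add: fundamental_def[abs_def])

text \<open>Apply \<open>metric_phi\<close> to X and \<phi>Y, then replace \<phi>\<phi>Y by -Y plus
  a multiple of \<xi>; \<xi> is orthogonal to the image of \<phi>.\<close>

lemma fundamental_skew:
  assumes "X \<in> VF" "Y \<in> VF"
  shows "fundamental X Y p = - fundamental Y X p"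
proof -
  have "g p (\<phi> p (X p)) (\<phi> p (\<phi> p (Y p))) = g p (X p) (\<phi> p (Y p))"
    using metric_phi[OF assms(1) vf_phi[OF assms(2)]] assms by simp
  then have "- g p (\<phi> p (X p)) (Y p) = g p (X p) (\<phi> p (Y p))"
    using assms metric_xi(2)[OF vf_phi[OF assms(1)], of p] by (simp add: phi_phi metric_linear)
  then show ?thesis using assms metric_sym[of "X p" p "\<phi> p (Y p)"] by (simp add: fundamental_def)
qed

lemma fundamental_xi [simp]:
  assumes "X \<in> VF"
  shows "fundamental X \<xi> p = 0" "fundamental \<xi> X p = 0"
  using assms metric_xi(2)[OF vf_phi, of X p] metric_linear_left(5)[of "X p" p 0]
  by (simp_all add: fundamental_def)

text \<open>Since \<eta> is g(\<xi>, .), this is metric compatibility with the prescribed value of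
  \<open>D X \<xi>\<close>.\<close>

lemma deriv_eta:
  assumes "X \<in> VF" "Y \<in> VF"
  shows "X p (\<lambda>q. \<eta> q (Y q)) = \<eta> p (D X Y p) + g p (X p) (Y p) - \<eta> p (X p) * \<eta> p (Y p)"
proof -
  have "X p (\<lambda>q. g q (\<xi> q) (Y q)) = g p (D X \<xi> p) (Y p) + g p (\<xi> p) (D X Y p)"
    by (rule metric_compatible) (use assms in auto)
  then show ?thesis using assms by (simp add: D_xi_apply metric_linear)
qed

lemma eta_simps:
  assumes "u \<in> tangent_space A p"
  shows "v \<in> tangent_space A p \<Longrightarrow> \<eta> p (u - v) = \<eta> p u - \<eta> p v" "\<eta> p (r *\<^sub>R u) = r * \<eta> p u"
proof -
  show "\<eta> p (r *\<^sub>R u) = r * \<eta> p u"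
    using eta_linear assms by (auto simp: linear_on_subspace_def)
  show "\<eta> p (u - v) = \<eta> p u - \<eta> p v" if "v \<in> tangent_space A p"
  proof -
    have "\<eta> p ((u - v) + v) = \<eta> p (u - v) + \<eta> p v"
      using eta_linear[of p] assms that by (simp only: linear_on_subspace_def tangent_space_closed)
    then show ?thesis by simp
  qed
qed

lemma eta_D_xi [simp]: "X \<in> VF \<Longrightarrow> \<eta> p (D X \<xi> p) = 0"
  by (simp add: D_xi_apply eta_simps)

text \<open>Differentiate D_Y \<xi> = Y - \<eta>(Y)\<xi> once more. The terms of
  \<open>deriv_eta\<close> symmetric in X and Y cancel, and those with \<open>D X Y\<close> and
  \<open>D Y X\<close> are absorbed by the bracket term.\<close>

lemma curvature_D_xi_right:
  assumes "X \<in> VF" "Y \<in> VF"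
  shows "curvature A D X Y \<xi> p = \<eta> p (X p) *\<^sub>R Y p - \<eta> p (Y p) *\<^sub>R X p"
proof -
  have D2: "D X (D Y \<xi>) p = D X Y p - (X p (\<lambda>q. \<eta> q (Y q)) *\<^sub>R \<xi> p + \<eta> p (Y p) *\<^sub>R D X \<xi> p)"
    if "X \<in> VF" "Y \<in> VF" for X Y
    using that by (simp add: D_xi[of Y] D_diff_right D_leibniz)
  have "curvature A D X Y \<xi> p = D X (D Y \<xi>) p - D Y (D X \<xi>) p - D (lie_bracket A X Y) \<xi> p"
    by (simp add: curvature_def)
  then show ?thesis using assms
    by (simp add: D2 D_xi_apply deriv_eta[OF assms] deriv_eta[OF assms(2,1)] torsion_free eta_simps
        metric_sym[of "Y p" p "X p"] algebra_simps)
qed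

text \<open>The defect from the asserted formula is symmetric in its first two arguments by the Bianchi
  identity and skew in its last two, hence zero.\<close>

lemma curvature_D_xi_middle:
  assumes "X \<in> VF" "Z \<in> VF"
  shows "curvature A D X \<xi> Z p = g p (X p) (Z p) *\<^sub>R \<xi> p - \<eta> p (Z p) *\<^sub>R X p"
proof -
  define Q where "Q X Z W = g p (curvature A D X \<xi> Z p - (g p (X p) (Z p) *\<^sub>R \<xi> p - \<eta> p (Z p) *\<^sub>R X p)) (W p)" for X Z W
  have Q: "Q X Z W = g p (curvature A D X \<xi> Z p) (W p) - g p (X p) (Z p) * \<eta> p (W p) + \<eta> p (Z p) * g p (X p) (W p)"
    if "X \<in> VF" "Z \<in> VF" "W \<in> VF" for X Z W
    using that by (simp add: Q_def metric_linear)
  have skew: "Q X Z W = - Q X W Z" if "X \<in> VF" "Z \<in> VF" "W \<in> VF" for X Z W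
    using that curvature_skew[of X \<xi> Z W p] by (simp add: Q)
  have sym: "Q X Z W = Q Z X W" if "X \<in> VF" "Z \<in> VF" "W \<in> VF" for X Z W
  proof -
    have "curvature A D X \<xi> Z p + curvature A D \<xi> Z X p + curvature A D Z X \<xi> p = 0"
      using fun_cong[OF bianchi[of X \<xi> Z], of p] that by simp
    then have "curvature A D X \<xi> Z p = curvature A D Z \<xi> X p - (\<eta> p (Z p) *\<^sub>R X p - \<eta> p (X p) *\<^sub>R Z p)"
      using fun_cong[OF curvature_swap[of \<xi> Z X], of p] that
      by (simp add: curvature_D_xi_right algebra_simps)
    then show ?thesis using that
      by (simp add: Q metric_linear metric_sym[of "X p" p "Z p"])
  qed
  \<comment> \<open>Three skew and three symmetric exchanges in alternation return to the original
    order with a minus sign.\<close>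
  have "Q X Z W = 0" if "W \<in> VF" for W
    using skew[of X Z W] sym[of X W Z] skew[of W X Z] sym[of W Z X] skew[of Z W X] sym[of Z X W] assms that
    by simp
  then have "curvature A D X \<xi> Z p - (g p (X p) (Z p) *\<^sub>R \<xi> p - \<eta> p (Z p) *\<^sub>R X p) = 0"
    using assms by (intro metric_nondegenerate) (auto simp: Q_def)
  then show ?thesis by simp
qed

section \<open>Curvature of the semi-symmetric non-metric connection\<close>

abbreviation "N \<equiv> semi_symmetric_connection \<phi> \<xi> g D"

lemma N_apply: "N X Y p = D X Y p + fundamental X Y p *\<^sub>R \<xi> p"
  by (simp add: semi_symmetric_connection_def fundamental_def)

lemma N_eq: "N X Y = D X Y + (\<lambda>p. fundamental X Y p *\<^sub>R \<xi> p)"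
  by (rule ext) (simp add: N_apply)

lemma N_xi [simp]: "X \<in> VF \<Longrightarrow> N X \<xi> = D X \<xi>" "X \<in> VF \<Longrightarrow> N \<xi> X = D \<xi> X"
  by (rule ext, simp add: N_apply)+

lemma fundamental_zero [simp]: "X \<in> VF \<Longrightarrow> fundamental X 0 p = 0" "X \<in> VF \<Longrightarrow> fundamental 0 X p = 0"
  using fundamental_skew[of X 0 p] metric_linear_right(5)[of "\<phi> p (X p)" p 0]
  by (simp_all add: fundamental_def)

lemma N_zero [simp]: "X \<in> VF \<Longrightarrow> N X 0 = 0" "X \<in> VF \<Longrightarrow> N 0 X = 0"
  by (rule ext, simp add: N_apply D_zero)+

text \<open>Derivatives of \<xi> are the same for \<open>N\<close> and \<open>D\<close>, so only the
  outer derivatives add a correction. It equals \<open>fundamental X Y\<close>, as \<xi> is null for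
  the 2-form, and skewness doubles it on antisymmetrising.\<close>

lemma curvature_N_xi_right:
  assumes "X \<in> VF" "Y \<in> VF"
  shows "curvature A N X Y \<xi> p =
    - \<eta> p (Y p) *\<^sub>R X p + \<eta> p (X p) *\<^sub>R Y p + (2 * fundamental X Y p) *\<^sub>R \<xi> p"
proof -
  have "fundamental X (D Y \<xi>) p = fundamental X Y p" if "X \<in> VF" "Y \<in> VF" for X Y
    using that metric_xi(2)[OF vf_phi, of X p] by (simp add: fundamental_def D_xi_apply metric_linear)
  then have "curvature A N X Y \<xi> p = curvature A D X Y \<xi> p + fundamental X Y p *\<^sub>R \<xi> p - fundamental Y X p *\<^sub>R \<xi> p"
    using assms by (simp add: curvature_def N_apply)
  then show ?thesis
    using assms by (simp add: curvature_D_xi_right fundamental_skew[of Y X p] algebra_simps flip: scaleR_2)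
qed

lemma phi_diff: "u \<in> tangent_space A p \<Longrightarrow> v \<in> tangent_space A p \<Longrightarrow> \<phi> p (u - v) = \<phi> p u - \<phi> p v"
proof -
  assume "u \<in> tangent_space A p" "v \<in> tangent_space A p"
  then have "\<phi> p ((u - v) + v) = \<phi> p (u - v) + \<phi> p v"
    using phi_linear[of p] by (simp only: linear_on_subspace_def tangent_space_closed)
  then show ?thesis by simp
qed

lemma phi_scale: "u \<in> tangent_space A p \<Longrightarrow> \<phi> p (r *\<^sub>R u) = r *\<^sub>R \<phi> p u"
  using phi_linear[of p] by (simp add: linear_on_subspace_def)

lemma curvature_N_xi_middle:
  assumes "X \<in> VF" "Z \<in> VF"
  shows "curvature A N X \<xi> Z p =
    - \<eta> p (Z p) *\<^sub>R X p + (g p (X p) (Z p) - fundamental X Z p) *\<^sub>R \<xi> p"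
proof -
  note VF = assms
  have "\<xi> p (fundamental X Z) = g p (D \<xi> (\<lambda>q. \<phi> q (X q)) p) (Z p) + fundamental X (D \<xi> Z) p"
    using metric_compatible[of \<xi> "\<lambda>q. \<phi> q (X q)" Z p] VF by (simp add: fundamental_def[abs_def])
  \<comment> \<open>By \<open>D_phi\<close> and \<phi> \<xi> = 0, \<phi> is parallel along \<xi>;
    hence the 2-form obeys a plain product rule in that direction.\<close>
  moreover have "D \<xi> (\<lambda>q. \<phi> q (X q)) p = \<phi> p (D \<xi> X p)"
    using D_phi[of \<xi> X p] metric_linear_left(5)[of "X p" p 0] VF by simp
  ultimately have deriv: "\<xi> p (fundamental X Z) = fundamental (D \<xi> X) Z p + fundamental X (D \<xi> Z) p"
    by (simp add: fundamental_def)
  \<comment> \<open>The bracket is \<open>D X \<xi> - D \<xi> X\<close>, and \<phi> kills the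
    \<xi>-component of \<open>D X \<xi>\<close>.\<close>
  have bracket: "fundamental (lie_bracket A X \<xi>) Z p = fundamental X Z p - fundamental (D \<xi> X) Z p"
    using VF metric_linear_left(5)[of "Z p" p 0]
    by (simp add: fundamental_def torsion_free D_xi_apply phi_diff phi_scale metric_linear)
  \<comment> \<open>Only the coefficient is differentiated, because
    \<open>D \<xi> \<xi> = 0\<close>.\<close>
  have "D \<xi> (D X Z + (\<lambda>p. fundamental X Z p *\<^sub>R \<xi> p)) p = D \<xi> (D X Z) p + \<xi> p (fundamental X Z) *\<^sub>R \<xi> p"
    using VF by (simp add: D_add_right D_leibniz)
  then have "curvature A N X \<xi> Z p = curvature A D X \<xi> Z p
      + (fundamental X (D \<xi> Z) p - \<xi> p (fundamental X Z) - fundamental (lie_bracket A X \<xi>) Z p) *\<^sub>R \<xi> p"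
    using VF by (simp add: curvature_def N_eq[of X Z]) (simp add: N_apply algebra_simps)
  then show ?thesis
    using VF by (simp add: deriv bracket curvature_D_xi_middle algebra_simps)
qed

section \<open>Ricci tensor with \<xi> in one slot\<close>

text \<open>Replaces the chosen extension in \<open>at_point\<close> by some field X about which
  only X(p) = v is known. This suffices, since the curvature formulas depend on X only through its
  value at \<open>p\<close>.\<close>

lemma at_pointE:
  assumes "v \<in> tangent_space A p"
  obtains X where "X \<in> VF" "X p = v" "at_point A F p v = F X p"
proof
  have "\<exists>X. X \<in> VF \<and> X p = v" using vector_field_extension[OF assms] by metis
  from someI_ex[OF this]
  show "(SOME X. X \<in> VF \<and> X p = v) \<in> VF" "(SOME X. X \<in> VF \<and> X p = v) p = v" by auto
qed (simp add: at_point_def)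

lemma metric_form_linear: "v \<in> tangent_space A p \<Longrightarrow> linear_on_subspace (tangent_space A p) (\<lambda>u. g p u v)"
  by (simp add: linear_on_subspace_def metric_linear)

lemma fundamental_form_linear:
  "v \<in> tangent_space A p \<Longrightarrow> linear_on_subspace (tangent_space A p) (\<lambda>u. g p (\<phi> p u) v)"
  using phi_linear[of p] by (simp add: linear_on_subspace_def metric_linear)

text \<open>The form \<eta> paired with Y contributes \<eta>(Y), while the 2-form term contributes
  its value at \<xi>, which is 0.\<close>

lemma ricci_xi_right:
  assumes "Y \<in> VF"
  shows "ricci A N Y \<xi> p = (1 - real CARD('n)) * \<eta> p (Y p)"
proof -
  let ?\<omega> = "\<lambda>u. 2 * g p (\<phi> p u) (Y p)"
  have "ricci A N Y \<xi> p = - \<eta> p (Y p) * CARD('n) + \<eta> p (Y p) + ?\<omega> (\<xi> p)"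
    unfolding ricci_def
  proof (rule endo_trace_scale_plus_rank_two[where \<omega> = "\<eta> p" and \<omega>' = ?\<omega>])
    fix v assume v: "v \<in> tangent_space A p"
    obtain X where "X \<in> VF" "X p = v"
      "at_point A (\<lambda>X. curvature A N X Y \<xi>) p v = curvature A N X Y \<xi> p"
      by (rule at_pointE[OF v])
    then show "at_point A (\<lambda>X. curvature A N X Y \<xi>) p v = - \<eta> p (Y p) *\<^sub>R v + \<eta> p v *\<^sub>R Y p + ?\<omega> v *\<^sub>R \<xi> p"
      using curvature_N_xi_right[of X Y p] assms by (simp add: fundamental_def)
  next
    show "linear_on_subspace (tangent_space A p) ?\<omega>"
      using fundamental_form_linear[of "Y p" p] assms by (simp add: linear_on_subspace_def)
  qed (use assms eta_linear in auto)
  then show ?thesis using fundamental_xi(2)[OF assms, of p] by (simp add: fundamental_def algebra_simps)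
qed

text \<open>The form g(., Z) paired with \<xi> contributes \<eta>(Z); the 2-form term again vanishes
  at \<xi>.\<close>

lemma ricci_xi_left:
  assumes "Z \<in> VF"
  shows "ricci A N \<xi> Z p = (1 - real CARD('n)) * \<eta> p (Z p)"
proof -
  let ?\<omega> = "\<lambda>u. - g p (\<phi> p u) (Z p)"
  have "ricci A N \<xi> Z p = - \<eta> p (Z p) * CARD('n) + g p (\<xi> p) (Z p) + ?\<omega> (\<xi> p)"
    unfolding ricci_def
  proof (rule endo_trace_scale_plus_rank_two[where \<omega> = "\<lambda>u. g p u (Z p)" and \<omega>' = ?\<omega>])
    fix v assume v: "v \<in> tangent_space A p"
    obtain X where "X \<in> VF" "X p = v"
      "at_point A (\<lambda>X. curvature A N X \<xi> Z) p v = curvature A N X \<xi> Z p"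
      by (rule at_pointE[OF v])
    then show "at_point A (\<lambda>X. curvature A N X \<xi> Z) p v =
        - \<eta> p (Z p) *\<^sub>R v + g p v (Z p) *\<^sub>R \<xi> p + ?\<omega> v *\<^sub>R \<xi> p"
      using curvature_N_xi_middle[of X Z p] assms by (simp add: fundamental_def algebra_simps)
  next
    show "linear_on_subspace (tangent_space A p) ?\<omega>"
      using fundamental_form_linear[of "Z p" p] assms by (simp add: linear_on_subspace_def)
  qed (use assms metric_form_linear in auto)
  then show ?thesis using fundamental_xi(2)[OF assms, of p] assms by (simp add: fundamental_def algebra_simps)
qed

text \<open>Serves the terms of the covariant derivative in which \<nabla>_\<xi> \<xi> = 0 fills a
  slot of the Ricci tensor. The traced endomorphism is 0, seen as a scalar plus two rank-one maps
  with all data 0.\<close>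

lemma ricci_zero:
  assumes "X \<in> VF"
  shows "ricci A N X 0 p = 0" "ricci A N 0 X p = 0"
proof -
  have "endo_trace (tangent_space A p) (at_point A F p) = 0" if "\<And>W. W \<in> VF \<Longrightarrow> F W = 0" for F
  proof -
    have "endo_trace (tangent_space A p) (at_point A F p) = 0 * real CARD('n) + 0 + 0"
    proof (rule endo_trace_scale_plus_rank_two[of p _ 0 "\<lambda>v. 0" 0 "\<lambda>v. 0" 0])
      fix v assume v: "v \<in> tangent_space A p"
      obtain X where "X \<in> VF" "X p = v" "at_point A F p v = F X p" by (rule at_pointE[OF v])
      then show "at_point A F p v = 0 *\<^sub>R v + 0 *\<^sub>R 0 + 0 *\<^sub>R 0" using that by simp
    qed (auto simp: linear_on_subspace_def)
    then show ?thesis by simp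
  qed
  note zero = this
  have N_VF: "N W X \<in> VF" if "W \<in> VF" for W
    using that assms by (simp add: N_eq)
  have "lie_bracket A W 0 = 0" if "W \<in> VF" for W
    using that by (simp add: torsion_free D_zero)
  then show "ricci A N X 0 p = 0" "ricci A N 0 X p = 0"
    using assms N_VF unfolding ricci_def by (intro zero; simp add: curvature_def)+
qed

section \<open>Consequences of weak Ricci symmetry\<close>

lemma weakly_ricci_symmetric_sum_zero:
  assumes "CARD('n) > 1" "weakly_ricci_symmetric A N \<alpha> \<beta> \<gamma>" "v \<in> tangent_space A p"
  shows "\<alpha> p v + \<beta> p v + \<gamma> p v = 0"
proof -
  \<comment> \<open>The common factor 1 - n of all Ricci values with \<xi> in a slot; it is nonzero
    for n > 1 and can be cancelled.\<close>
  define k where "k = 1 - real CARD('n)"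
  have k: "k \<noteq> 0" using assms(1) by (simp add: k_def)
  have wrs: "cov_deriv N (ricci A N) X Y Z p =
      \<alpha> p (X p) * ricci A N Y Z p + \<beta> p (Y p) * ricci A N X Z p + \<gamma> p (Z p) * ricci A N X Y p"
    if "X \<in> VF" "Y \<in> VF" "Z \<in> VF" for X Y Z
    using assms(2) that by (simp add: weakly_ricci_symmetric_def)
  have right: "ricci A N Y \<xi> = (\<lambda>q. k * \<eta> q (Y q))" and left: "ricci A N \<xi> Y = (\<lambda>q. k * \<eta> q (Y q))"
    if "Y \<in> VF" for Y
    using that by (auto simp: k_def ricci_xi_right ricci_xi_left)
  obtain V where V: "V \<in> VF" "V p = v" using vector_field_extension[OF assms(3)] .
  \<comment> \<open>The Ricci value at (\<xi>, \<xi>) is the constant \<open>k\<close>, and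
    \<open>D X \<xi>\<close> is annihilated by \<eta>.\<close>
  have "cov_deriv N (ricci A N) X \<xi> \<xi> p = 0" if "X \<in> VF" for X
    using that by (simp add: cov_deriv_def left right tangent_const[OF vf_tangent[OF that]])
  then have "k * (\<alpha> p (X p) + (\<beta> p (\<xi> p) + \<gamma> p (\<xi> p)) * \<eta> p (X p)) = 0" if "X \<in> VF" for X
    using wrs[OF that vf_xi vf_xi] that by (simp add: left right algebra_simps)
  then have 1: "\<alpha> p (X p) + (\<beta> p (\<xi> p) + \<gamma> p (\<xi> p)) * \<eta> p (X p) = 0" if "X \<in> VF" for X
    using that k by simp
  \<comment> \<open>In direction \<xi> the two extra terms of \<open>deriv_eta\<close> are both
    \<eta>(V) and cancel.\<close>
  have "\<xi> p (\<lambda>q. k * \<eta> q (V q)) = k * \<eta> p (D \<xi> V p)"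
    using V(1) by (simp add: tangent_cmul[OF vf_tangent[OF vf_xi]] deriv_eta[OF vf_xi])
  then have "cov_deriv N (ricci A N) \<xi> V \<xi> p = 0" "cov_deriv N (ricci A N) \<xi> \<xi> V p = 0"
    using V(1) by (simp_all add: cov_deriv_def left right ricci_zero)
  then have "k * (\<beta> p v + (\<alpha> p (\<xi> p) + \<gamma> p (\<xi> p)) * \<eta> p v) = 0"
    and "k * (\<gamma> p v + (\<alpha> p (\<xi> p) + \<beta> p (\<xi> p)) * \<eta> p v) = 0"
    using wrs[of \<xi> V \<xi>] wrs[of \<xi> \<xi> V] V by (simp_all add: left right algebra_simps)
  then have 2: "\<beta> p v + (\<alpha> p (\<xi> p) + \<gamma> p (\<xi> p)) * \<eta> p v = 0"
    and 3: "\<gamma> p v + (\<alpha> p (\<xi> p) + \<beta> p (\<xi> p)) * \<eta> p v = 0"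
    using k by simp_all
  \<comment> \<open>In the sum of the three relations each of \<alpha>(\<xi>), \<beta>(\<xi>),
    \<gamma>(\<xi>) occurs twice.\<close>
  have "\<alpha> p v + \<beta> p v + \<gamma> p v = - 2 * (\<alpha> p (\<xi> p) + \<beta> p (\<xi> p) + \<gamma> p (\<xi> p)) * \<eta> p v"
    using 1[OF V(1)] 2 3 V(2) by (simp add: algebra_simps)
  then show ?thesis using 1[OF vf_xi] by simp
qed

end

theorem theorem5p6:
  fixes A :: "('a::{t2_space, second_countable_topology}, 'n::finite) chart set"
    and \<phi> :: "'a \<Rightarrow> 'a tangent \<Rightarrow> 'a tangent"
    and \<xi> :: "'a field"
    and \<eta> \<alpha> \<beta> \<gamma> :: "'a \<Rightarrow> 'a tangent \<Rightarrow> real"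
    and g :: "'a metric_tensor"
    and D :: "'a connection"
  assumes "smooth_atlas A"
    and "CARD('n) > 3"
    and "kenmotsu A \<phi> \<xi> \<eta> g D"
    and "weakly_ricci_symmetric A (semi_symmetric_connection \<phi> \<xi> g D) \<alpha> \<beta> \<gamma>"
  shows "\<forall>p. \<forall>v\<in>tangent_space A p. \<alpha> p v + \<beta> p v + \<gamma> p v = 0"
proof (intro allI ballI)
  fix p v assume v: "v \<in> tangent_space A p"
  interpret kenmotsu_manifold A g D \<phi> \<xi> \<eta>
    using assms(1,3) by unfold_locales (simp_all add: kenmotsu_def)
  show "\<alpha> p v + \<beta> p v + \<gamma> p v = 0"
    using weakly_ricci_symmetric_sum_zero[OF _ assms(4) v] assms(2) by simp
qed

end
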